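(* Suppose that $(u^0,u^1)\setminus I_0\neq\emptyset$ and $(u^0,u^1)\setminus I_1\neq\emptyset$. Then for every $\epsilon>0$ there exist $k\in K$ and $\rho\in P$ with $\rho_i<\epsilon$ for all $i\in\mathbb Z$ such that there is a minimizer $x^\ast$ of $J=J_{k,\rho}$ in $X_{k,\rho}$ which is a stationary configuration with rotation number $0$.
   Context: Standing assumptions: $h:\mathbb R^2\to\mathbb R$ is Lipschitz continuous and satisfies: (h1) $h(\xi,\eta)=h(\xi+1,\eta+1)$ for all $\xi,\eta$; (h2) $h(\xi,\xi+\eta)\to\infty$ as $|\eta|\to\infty$, uniformly in $\xi$; (h3) if $\underline\xi<\bar\xi$ and $\underline\eta<\bar\eta$ then $h(\underline\xi,\underline\eta)+h(\bar\xi,\bar\eta)<h(\underline\xi,\bar\eta)+h(\bar\xi,\underline\eta)$; (h4) if $(x,x_0,x_1)$ and $(\xi,x_0,\xi_1)$ are minimal and distinct then $(x-\xi)(x_1-\xi_1)<0$; (h5) there is a positive continuous function $p$ on $\mathbb R^2$ with $h(\xi,\eta')+h(\eta,\xi')-h(\xi,\xi')-h(\eta,\eta')>\int_\xi^\eta\int_{\xi'}^{\eta'}p$ whenever $\xi<\eta$ and $\xi'<\eta'$; (h6) there is $\theta>0$ such that $\xi\mapsto\theta\xi^2/2-h(\xi,\xi')$ is convex for every $\xi'$ and $\xi'\mapsto\theta\xi'^2/2-h(\xi,\xi')$ is convex for every $\xi$. Here $h(x_m,\dots,x_n)=\sum_{i=m}^{n-1}h(x_i,x_{i+1})$. A finite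 sequence is minimal if for each of its segments $(x_{n_0},\dots,x_{n_1})$ and each $(y_{n_0},\dots,y_{n_1})$ with the same end points, $h(x_{n_0},\dots,x_{n_1})\le h(y_{n_0},\dots,y_{n_1})$; a bi-infinite sequence (configuration) is minimal if all its finite segments are. A configuration $x\in\mathbb R^{\mathbb Z}$ is stationary if $\partial_2h(x_{i-1},x_i)+\partial_1h(x_i,x_{i+1})=0$ for all $i\in\mathbb Z$ (partial derivatives being understood, where needed, as left-sided derivatives). It has rotation number $\alpha$ if $\lim_{i\to\infty}x_i/i=\lim_{i\to-\infty}x_i/i=\alpha$. $(u^0,u^1)$, $u^0<u^1$, is a fixed neighboring pair: the constant configurations $u^0$ and $u^1$ are minimal and no constant configuration $u$ with $u^0<u<u^1$ is minimal. $c=\min_{x\in\mathbb R}h(x,x)=h(u^0,u^0)=h(u^1,u^1)$. $I_0$ is the set of $x_0\in\mathbb R$ for which there is a minimal configuration $x=(x_i)$ with rotation number $0$, $x_i\to u^0$ as $i\to-\infty$ and $x_i\to u^1$ as $i\to\infty$; $I_1$ is the set of $x_0$ for which there is a minimal configuration $x$ with rotation number $0$, $x_i\to u^1$ as $i\to-\infty$ and $x_i\to u^0$ as $i\to\infty$. $X=\{x\in\mathbb R^{\mathbb Z}: u^0\le x_i\le u^1\ \forall i\}$, $Y^j(l,r)=\{x\in X:|x_l-u^j|\le r\}$ ($j=0,1$). $K=\{(k_i)_{i\in\mathbb Z}\subset\mathbb Z: k_0=0,\ k_i<k_{i+1}\ \forall i\}$; $P=\{(\rho_i)_{i\in\mathbb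 Z}: 0<\rho_i<(u^1-u^0)/2,\ \sum_{i\in\mathbb Z}\rho_i<\infty\}$. With $\equiv$ meaning congruence modulo $4$, $X_{k,\rho}=\bigcap_{i\equiv0,1}Y^0(k_i,\rho_i)\cap\bigcap_{i\equiv-1,2}Y^1(k_i,\rho_i)$. Put $I_i=\{k_i,\dots,k_{i+1}-1\}$, $|I_i|=k_{i+1}-k_i$, and $c_i^+=\min\{\sum_{j\in I_i}h(x_j,x_{j+1}): x\in Y^0(k_i,\rho_i)\cap Y^1(k_{i+1},\rho_{i+1})\}$, $c_i^-=\min\{\sum_{j\in I_i}h(x_j,x_{j+1}): x\in Y^1(k_i,\rho_i)\cap Y^0(k_{i+1},\rho_{i+1})\}$. Set $A_i(x)=\sum_{j\in I_i}h(x_j,x_{j+1})-|I_i|c$ if $i\equiv0,2$; $A_i(x)=\sum_{j\in I_i}h(x_j,x_{j+1})-c_i^+$ if $i\equiv1$; $A_i(x)=\sum_{j\in I_i}h(x_j,x_{j+1})-c_i^-$ if $i\equiv-1$. For $x\in X_{k,\rho}$, $J(x)=J_{k,\rho}(x)=\sum_{i\in\mathbb Z}A_i(x)=\lim_{n\to\infty}\sum_{|i|\le n}A_i(x)\in\mathbb R\cup\{+\infty\}$. *)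

theory Defs
  imports "HOL-Analysis.Analysis"
begin

type_synonym config = "int \<Rightarrow> real"

definition energy :: "(real \<Rightarrow> real \<Rightarrow> real) \<Rightarrow> config \<Rightarrow> int \<Rightarrow> int \<Rightarrow> real" where
  "energy h x m n = (\<Sum>i\<in>{m..<n}. h (x i) (x (i + 1)))"

text \<open>A finite sequence \<open>(x\<^sub>m, \<dots>, x\<^sub>n)\<close> is represented by a configuration of which only the
  values at indices in \<open>{m..n}\<close> matter.\<close>

definition minimal_between :: "(real \<Rightarrow> real \<Rightarrow> real) \<Rightarrow> int \<Rightarrow> int \<Rightarrow> config \<Rightarrow> bool" where
  "minimal_between h m n x \<longleftrightarrow>
     (\<forall>n0 n1. m \<le> n0 \<longrightarrow> n0 < n1 \<longrightarrow> n1 \<le> n \<longrightarrow>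
        (\<forall>y. y n0 = x n0 \<longrightarrow> y n1 = x n1 \<longrightarrow> energy h x n0 n1 \<le> energy h y n0 n1))"

definition minimal :: "(real \<Rightarrow> real \<Rightarrow> real) \<Rightarrow> config \<Rightarrow> bool" where
  "minimal h x \<longleftrightarrow> (\<forall>m n. minimal_between h m n x)"

text \<open>Left-sided derivatives agree with the ordinary partial derivatives wherever the latter exist.
  When \<open>h\<close> is a quadratic minus a convex function in each variable, they exist everywhere.\<close>

definition stationary :: "(real \<Rightarrow> real \<Rightarrow> real) \<Rightarrow> config \<Rightarrow> bool" where
  "stationary h x \<longleftrightarrow>
     (\<forall>i. \<exists>a b. ((\<lambda>t. h (x (i - 1)) t) has_real_derivative a) (at_left (x i)) \<and>
                ((\<lambda>t. h t (x (i + 1))) has_real_derivative b) (at_left (x i)) \<and>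
                a + b = 0)"

definition has_rotation_number :: "config \<Rightarrow> real \<Rightarrow> bool" where
  "has_rotation_number x \<alpha> \<longleftrightarrow>
     ((\<lambda>i. x i / of_int i) \<longlongrightarrow> \<alpha>) at_top \<and> ((\<lambda>i. x i / of_int i) \<longlongrightarrow> \<alpha>) at_bot"

definition neighboring_pair :: "(real \<Rightarrow> real \<Rightarrow> real) \<Rightarrow> real \<Rightarrow> real \<Rightarrow> bool" where
  "neighboring_pair h u0 u1 \<longleftrightarrow>
     u0 < u1 \<and> minimal h (\<lambda>_. u0) \<and> minimal h (\<lambda>_. u1) \<and>
     (\<forall>u. u0 < u \<and> u < u1 \<longrightarrow> \<not> minimal h (\<lambda>_. u))"

text \<open>\<open>connecting h a b\<close> is the set \<open>I\<^sub>0\<close> for \<open>(a, b) = (u\<^sup>0, u\<^sup>1)\<close> and the set \<open>I\<^sub>1\<close> for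
  \<open>(a, b) = (u\<^sup>1, u\<^sup>0)\<close>.\<close>

definition connecting :: "(real \<Rightarrow> real \<Rightarrow> real) \<Rightarrow> real \<Rightarrow> real \<Rightarrow> real set" where
  "connecting h a b =
     {x 0 | x. minimal h x \<and> has_rotation_number x 0 \<and> (x \<longlongrightarrow> a) at_bot \<and> (x \<longlongrightarrow> b) at_top}"

definition strip :: "real \<Rightarrow> real \<Rightarrow> config set" where
  "strip u0 u1 = {x. \<forall>i. u0 \<le> x i \<and> x i \<le> u1}"

text \<open>\<open>near u0 u1 v l r\<close> is \<open>Y\<^sup>j(l, r)\<close> with \<open>v = u\<^sup>j\<close>.\<close>

definition near :: "real \<Rightarrow> real \<Rightarrow> real \<Rightarrow> int \<Rightarrow> real \<Rightarrow> config set" where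
  "near u0 u1 v l r = {x \<in> strip u0 u1. \<bar>x l - v\<bar> \<le> r}"

definition index_seqs :: "(int \<Rightarrow> int) set" where
  "index_seqs = {k. k 0 = 0 \<and> (\<forall>i. k i < k (i + 1))}"

definition radius_seqs :: "real \<Rightarrow> real \<Rightarrow> (int \<Rightarrow> real) set" where
  "radius_seqs u0 u1 = {\<rho>. (\<forall>i. 0 < \<rho> i \<and> \<rho> i < (u1 - u0) / 2) \<and> \<rho> summable_on UNIV}"

text \<open>In residues modulo 4, the class of \<open>-1\<close> is that of \<open>3\<close>.\<close>

definition constrained ::
    "real \<Rightarrow> real \<Rightarrow> (int \<Rightarrow> int) \<Rightarrow> (int \<Rightarrow> real) \<Rightarrow> config set" where
  "constrained u0 u1 k \<rho> =
     (\<Inter>i\<in>{i. i mod 4 = 0 \<or> i mod 4 = 1}. near u0 u1 u0 (k i) (\<rho> i)) \<inter>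
     (\<Inter>i\<in>{i. i mod 4 = 3 \<or> i mod 4 = 2}. near u0 u1 u1 (k i) (\<rho> i))"

text \<open>The infima below are minima for continuous \<open>h\<close>: the diagonal of \<open>h\<close> is periodic under
  \<open>h \<xi> \<eta> = h (\<xi> + 1) (\<eta> + 1)\<close>, and a segment energy depends on finitely many coordinates,
  which range over a nonempty compact set.\<close>

definition diag_min :: "(real \<Rightarrow> real \<Rightarrow> real) \<Rightarrow> real" where
  "diag_min h = (INF x. h x x)"

text \<open>\<open>transition_min h u0 u1 k \<rho> a b i\<close> is \<open>c\<^sub>i\<^sup>+\<close> for \<open>(a, b) = (u\<^sup>0, u\<^sup>1)\<close> and \<open>c\<^sub>i\<^sup>-\<close> for
  \<open>(a, b) = (u\<^sup>1, u\<^sup>0)\<close>.\<close>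

definition transition_min ::
    "(real \<Rightarrow> real \<Rightarrow> real) \<Rightarrow> real \<Rightarrow> real \<Rightarrow> (int \<Rightarrow> int) \<Rightarrow> (int \<Rightarrow> real) \<Rightarrow>
     real \<Rightarrow> real \<Rightarrow> int \<Rightarrow> real" where
  "transition_min h u0 u1 k \<rho> a b i =
     (INF x \<in> near u0 u1 a (k i) (\<rho> i) \<inter> near u0 u1 b (k (i + 1)) (\<rho> (i + 1)).
        energy h x (k i) (k (i + 1)))"

definition renormalized_energy ::
    "(real \<Rightarrow> real \<Rightarrow> real) \<Rightarrow> real \<Rightarrow> real \<Rightarrow> (int \<Rightarrow> int) \<Rightarrow> (int \<Rightarrow> real) \<Rightarrow>
     int \<Rightarrow> config \<Rightarrow> real" where
  "renormalized_energy h u0 u1 k \<rho> i x =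
     energy h x (k i) (k (i + 1)) -
     (if i mod 4 = 1 then transition_min h u0 u1 k \<rho> u0 u1 i
      else if i mod 4 = 3 then transition_min h u0 u1 k \<rho> u1 u0 i
      else of_int (k (i + 1) - k i) * diag_min h)"

definition action ::
    "(real \<Rightarrow> real \<Rightarrow> real) \<Rightarrow> real \<Rightarrow> real \<Rightarrow> (int \<Rightarrow> int) \<Rightarrow> (int \<Rightarrow> real) \<Rightarrow>
     config \<Rightarrow> ereal" where
  "action h u0 u1 k \<rho> x =
     lim (\<lambda>n. ereal (\<Sum>i\<in>{- int n..int n}. renormalized_energy h u0 u1 k \<rho> i x))"

end

theory Submission
  imports Defs
begin

text \<open>
  Write \<open>c\<close> for the minimum of \<open>h\<close> on the diagonal and call \<open>h v v - c\<close> the diagonal energy of \<open>v\<close>. By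
  the twist condition a closed loop costs at least as much as resting at each of its points for one step
  (\<open>loop_sum_ge_diagonal\<close>). So constant configurations are minimal exactly on the minimum set
  of the diagonal, and a long segment of bounded excess energy comes close to \<open>u0\<close> or \<open>u1\<close>.

  Let \<open>pot a b\<close> be the least excess energy over \<open>c\<close> for travelling from \<open>a\<close> to \<open>b\<close> in the strip.
  A round trip between \<open>u0\<close> and \<open>u1\<close> has positive cost (\<open>round_trip_pos\<close>). A point \<open>z\<close> is critical for
  the pair \<open>(a, b)\<close> if \<open>pot a z + pot z b = pot a b\<close>. Every critical point other than \<open>u0\<close> and \<open>u1\<close> has a unique
  optimal predecessor and successor, and the resulting orbit is a minimal configuration from \<open>a\<close> to \<open>b\<close>
  (\<open>crit_connecting\<close>). So a point missed by all connecting minimal configurations is noncritical: a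
  detour through it has positive cost. The predecessor map preserves order and moves gaps of the critical
  set to gaps closer and closer to \<open>a\<close>; reversing time moves them to \<open>b\<close> (\<open>gap_near_source\<close>,
  \<open>gap_near_target\<close>). Hence noncritical points exist arbitrarily close to both ground states, in both
  directions of transition.

  Choose the radii \<open>\<rho> i\<close> so small and such that the boundary value of each constraint inside the strip is
  noncritical, and then the intervals so long that a minimizer comes very close to the ground states
  inside the rest intervals, on the scale of the detour costs of the adjacent boundary values. If the minimizer attained
  such a boundary value, replacing the piece between two such close approaches by a near-optimal
  transition would save energy (\<open>avoids_noncritical_value\<close>). So all constraints are strict.

  A minimizer exists because, after adding a summable correction, the action is an increasing
  limit of continuous functions on a compact set, and it is finite at a configuration that follows almost
  optimal transitions (\<open>exists_action_minimizer\<close>). As its constraints are strict, each coordinate is a local minimum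
  of the energy of its two adjacent steps, and semiconcavity gives stationarity
  (\<open>strict_imp_stationary\<close>). The rotation number vanishes because the configuration is bounded.
\<close>

section \<open>Loops and the twist condition\<close>

lemma sum_lessThan_add:
  fixes f :: "nat \<Rightarrow> real"
  shows "(\<Sum>i<m+r. f i) = (\<Sum>i<m. f i) + (\<Sum>i<r. f (m+i))"
  by (induction r) auto

text \<open>A nonconstant loop has an entry, away from the endpoint, that is at least as large or at least as
  small as both of its neighbours. By the twist condition, replacing the two steps through this
  entry by one step between its neighbours and one constant step does not raise the sum. Induction
  on the length reduces the loop to constant steps.\<close>

lemma loop_sum_ge_diagonal:
  fixes h :: "real \<Rightarrow> real \<Rightarrow> real" and f :: "nat \<Rightarrow> real"
  assumes twist: "\<And>x x' y y'. x < x' \<Longrightarrow> y < y' \<Longrightarrow> h x y + h x' y' < h x y' + h x' y"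
  shows "f 0 = f N \<Longrightarrow> (\<Sum>i<N. h (f i) (f i)) \<le> (\<Sum>i<N. h (f i) (f (Suc i)))"
proof (induction N arbitrary: f)
  case 0
  then show ?case by simp
next
  case (Suc N)
  have weak: "h x y + h x' y' \<le> h x y' + h x' y" if "x \<le> x'" "y \<le> y'" for x x' y y'
    using twist[of x x' y y'] that by (cases "x = x' \<or> y = y'") auto
  show ?case
  proof (cases "N = 0")
    case True
    then show ?thesis using Suc.prems by simp
  next
    case False
    have fin: "finite (f ` {1..N})" "f ` {1..N} \<noteq> {}" using False by auto
    have "\<exists>p<N. h (f p) (f (Suc (Suc p))) + h (f (Suc p)) (f (Suc p))
             \<le> h (f p) (f (Suc p)) + h (f (Suc p)) (f (Suc (Suc p)))"
    proof (cases "\<exists>j\<in>{1..N}. f j > f 0")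
      case True
      obtain j where j: "j \<in> {1..N}" "f j = Max (f ` {1..N})"
        using Max_in[OF fin] by (metis imageE)
      have max: "f i \<le> f j" if "i \<in> {1..N}" for i
        using that Max_ge[OF fin(1)] j by simp
      then have max0: "f 0 \<le> f j" using True by force
      have "f i \<le> f j" if "i \<le> Suc N" for i
        using max[of i] max0 that Suc.prems by (cases "i = 0 \<or> i = Suc N") auto
      then have "f (j - 1) \<le> f j" "f (Suc j) \<le> f j" using j by auto
      then show ?thesis
        using weak[of "f (j-1)" "f j" "f (Suc j)" "f j"] j
        by (intro exI[of _ "j-1"]) (auto simp: algebra_simps)
    next
      case False
      obtain j where j: "j \<in> {1..N}" "f j = Min (f ` {1..N})"
        using Min_in[OF fin] by (metis imageE)
      have min: "f i \<ge> f j" if "i \<in> {1..N}" for i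
        using that Min_le[OF fin(1)] j by simp
      have min0: "f 0 \<ge> f j" using False j(1) by (meson not_less)
      have "f i \<ge> f j" if "i \<le> Suc N" for i
        using min[of i] min0 that Suc.prems by (cases "i = 0 \<or> i = Suc N") auto
      then have "f (j - 1) \<ge> f j" "f (Suc j) \<ge> f j" using j by auto
      then show ?thesis
        using weak[of "f j" "f (j-1)" "f j" "f (Suc j)"] j
        by (intro exI[of _ "j-1"]) (auto simp: algebra_simps)
    qed
    then obtain p where p: "p < N"
      "h (f p) (f (Suc (Suc p))) + h (f (Suc p)) (f (Suc p))
             \<le> h (f p) (f (Suc p)) + h (f (Suc p)) (f (Suc (Suc p)))" by blast
    obtain r where r: "N = Suc p + r" using p(1) less_iff_Suc_add by auto
    define g where "g i = (if i \<le> p then f i else f (Suc i))" for i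
    have g: "(\<Sum>i<N. h (g i) (g i)) \<le> (\<Sum>i<N. h (g i) (g (Suc i)))"
      by (rule Suc.IH) (use Suc.prems p in \<open>auto simp: g_def\<close>)
    have split1: "(\<Sum>i<Suc N. a i) = (\<Sum>i<p. a i) + a p + a (Suc p) + (\<Sum>i<r. a (Suc (Suc (p+i))))"
      for a :: "nat \<Rightarrow> real"
      using sum_lessThan_add[of a "Suc (Suc p)" r] r by simp
    have split2: "(\<Sum>i<N. a i) = (\<Sum>i<p. a i) + a p + (\<Sum>i<r. a (Suc (p+i)))"
      for a :: "nat \<Rightarrow> real"
      using sum_lessThan_add[of a "Suc p" r] r by simp
    have d: "(\<Sum>i<Suc N. h (f i) (f i)) = (\<Sum>i<N. h (g i) (g i)) + h (f (Suc p)) (f (Suc p))"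
      unfolding split1 split2 by (simp add: g_def)
    have e: "(\<Sum>i<Suc N. h (f i) (f (Suc i))) = (\<Sum>i<N. h (g i) (g (Suc i)))
       - h (f p) (f (Suc (Suc p))) + h (f p) (f (Suc p)) + h (f (Suc p)) (f (Suc (Suc p)))"
      unfolding split1 split2 by (simp add: g_def)
    show ?thesis using d e g p by linarith
  qed
qed

lemma sum_int_interval_nat:
  fixes f :: "int \<Rightarrow> real"
  shows "(\<Sum>i\<in>{m..<m + int N}. f i) = (\<Sum>i<N. f (m + int i))"
proof (induction N)
  case (Suc N)
  have "{m..<m + int (Suc N)} = insert (m + int N) {m..<m + int N}" by auto
  then show ?case using Suc by simp
qed simp

lemma energy_loop_ge_diagonal:
  fixes h :: "real \<Rightarrow> real \<Rightarrow> real"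
  assumes twist: "\<And>x x' y y'. x < x' \<Longrightarrow> y < y' \<Longrightarrow> h x y + h x' y' < h x y' + h x' y"
    and "m \<le> n" "x m = x n"
  shows "(\<Sum>i\<in>{m..<n}. h (x i) (x i)) \<le> energy h x m n"
proof -
  define N where "N = nat (n - m)"
  have n: "n = m + int N" using assms by (simp add: N_def)
  show ?thesis
    using loop_sum_ge_diagonal[of h "\<lambda>i. x (m + int i)" N, OF twist] assms
    unfolding energy_def n sum_int_interval_nat by (simp add: algebra_simps)
qed

lemma transition_exists:
  fixes P :: "int \<Rightarrow> bool"
  assumes "m \<le> n" "P m" "\<not> P n"
  shows "\<exists>i. m \<le> i \<and> i < n \<and> P i \<and> \<not> P (i + 1)"
proof (rule ccontr)
  assume a: "\<not> ?thesis"
  have "i \<le> n \<longrightarrow> P i" if "m \<le> i" for i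
    using that by (induction rule: int_ge_induct) (use a assms in auto)
  then show False using assms by auto
qed

section \<open>Excess energy between two ground states\<close>

text \<open>The number \<open>c\<close> is the ground state energy per step, attained on the diagonal at \<open>u0\<close> and \<open>u1\<close>, and
  \<open>triple\<close> says that distinct minimal triples with a common middle entry cross there. All hypotheses are
  invariant under exchanging the arguments of \<open>h\<close>, which reverses time. This symmetry turns
  statements about the start of a transition into statements about its end.\<close>

locale twist_strip =
  fixes h :: "real \<Rightarrow> real \<Rightarrow> real" and u0 u1 L c :: real
  assumes less: "u0 < u1" and Lpos: "0 < L"
    and lip1: "\<And>x x' y. \<bar>h x y - h x' y\<bar> \<le> L * \<bar>x - x'\<bar>"
    and lip2: "\<And>x y y'. \<bar>h x y - h x y'\<bar> \<le> L * \<bar>y - y'\<bar>"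
    and twist: "\<And>x x' y y'. x < x' \<Longrightarrow> y < y' \<Longrightarrow> h x y + h x' y' < h x y' + h x' y"
    and triple: "\<And>p p' q r r'. (\<And>t. h p q + h q r \<le> h p t + h t r) \<Longrightarrow>
        (\<And>t. h p' q + h q r' \<le> h p' t + h t r') \<Longrightarrow> (p, r) \<noteq> (p', r') \<Longrightarrow>
        (p - p') * (r - r') < 0"
    and diag: "\<And>v. c \<le> h v v" and hu0: "h u0 u0 = c" and hu1: "h u1 u1 = c"
    and pos: "\<And>v. u0 < v \<Longrightarrow> v < u1 \<Longrightarrow> c < h v v"
begin

text \<open>Subtracting the ground state energy in every step makes resting at \<open>u0\<close> or \<open>u1\<close> free, so
  segments of different lengths can be compared.\<close>

definition exc :: "config \<Rightarrow> int \<Rightarrow> int \<Rightarrow> real" where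
  "exc x m n = (\<Sum>i\<in>{m..<n}. h (x i) (x (i + 1)) - c)"

lemma energy_exc: "m \<le> n \<Longrightarrow> energy h x m n = exc x m n + of_int (n - m) * c"
  by (simp add: energy_def exc_def sum_subtractf)

lemma exc_same [simp]: "exc x m m = 0"
  by (simp add: exc_def)

lemma exc_step: "exc x m (m + 1) = h (x m) (x (m + 1)) - c"
proof -
  have "{m..<m+1} = {m}" by auto
  then show ?thesis by (simp add: exc_def)
qed

lemma exc_split: "m \<le> l \<Longrightarrow> l \<le> n \<Longrightarrow> exc x m n = exc x m l + exc x l n"
  unfolding exc_def
  by (subst sum.union_disjoint[symmetric]) (auto simp: ivl_disj_un)

lemma exc_last: "m < n \<Longrightarrow> exc x m n = exc x m (n - 1) + (h (x (n - 1)) (x n) - c)"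
  using exc_split[of m "n-1" n x] exc_step[of x "n-1"] by simp

lemma exc_cong: "(\<And>i. m \<le> i \<Longrightarrow> i \<le> n \<Longrightarrow> x i = y i) \<Longrightarrow> exc x m n = exc y m n"
  unfolding exc_def by (intro sum.cong) auto

lemma exc_shift: "exc (\<lambda>i. x (i + s)) m n = exc x (m + s) (n + s)"
  unfolding exc_def
  by (rule sum.reindex_bij_witness[of _ "\<lambda>i. i - s" "\<lambda>i. i + s"]) (auto simp: algebra_simps)

lemma weak_twist: "x \<le> x' \<Longrightarrow> y \<le> y' \<Longrightarrow> h x y + h x' y' \<le> h x y' + h x' y"
  using twist[of x x' y y'] by (cases "x = x' \<or> y = y'") auto

text \<open>Moving the last point onto the first closes the segment and costs at most \<open>L\<close> times their distance;
  the loop inequality applies to the result. Thus a segment of bounded excess energy, however long, has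
  bounded total diagonal energy and must spend most of its time near the ground states.\<close>

lemma exc_ge:
  assumes "m \<le> n"
  shows "(\<Sum>i\<in>{m..<n}. h (x i) (x i) - c) - L * \<bar>x n - x m\<bar> \<le> exc x m n"
proof (cases "m = n")
  case False
  then have mn: "m < n" using assms by simp
  define y where "y = x(n := x m)"
  have "(\<Sum>i\<in>{m..<n}. h (y i) (y i)) \<le> energy h y m n"
    using mn by (intro energy_loop_ge_diagonal twist) (auto simp: y_def)
  moreover have "(\<Sum>i\<in>{m..<n}. h (y i) (y i)) = (\<Sum>i\<in>{m..<n}. h (x i) (x i))"
    by (intro sum.cong) (auto simp: y_def)
  ultimately have 1: "(\<Sum>i\<in>{m..<n}. h (x i) (x i) - c) \<le> exc y m n"
    using mn by (simp add: energy_exc sum_subtractf)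
  have "exc y m (n-1) = exc x m (n-1)"
    by (rule exc_cong) (auto simp: y_def)
  moreover have "h (y (n-1)) (y n) \<le> h (x (n-1)) (x n) + L * \<bar>x n - x m\<bar>"
    using lip2[of "x (n-1)" "x n" "x m"] mn by (auto simp: y_def)
  ultimately have "exc y m n \<le> exc x m n + L * \<bar>x n - x m\<bar>"
    using exc_last[OF mn, of x] exc_last[OF mn, of y] by linarith
  then show ?thesis using 1 by linarith
qed simp

lemma exc_ge_dist: "m \<le> n \<Longrightarrow> - L * \<bar>x n - x m\<bar> \<le> exc x m n"
  using exc_ge[of m n x] sum_nonneg[of "{m..<n}" "\<lambda>i. h (x i) (x i) - c"] diag by simp

lemma h_le_near:
  assumes "h a a = c"
  shows "\<bar>h p q - c\<bar> \<le> L * \<bar>p - a\<bar> + L * \<bar>q - a\<bar>"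
  using lip1[of p q a] lip2[of a q a] assms by linarith

lemma exc_rest_le:
  assumes a: "h a a = c" and mn: "m < n" and y: "\<And>i. m < i \<Longrightarrow> i < n \<Longrightarrow> y i = a"
  shows "exc y m n \<le> L * \<bar>y m - a\<bar> + L * \<bar>y n - a\<bar>"
proof -
  have "exc y m n \<le> (\<Sum>i\<in>{m..<n}. L * \<bar>y i - a\<bar> + L * \<bar>y (i+1) - a\<bar>)"
    unfolding exc_def using h_le_near[OF a] by (intro sum_mono) (metis abs_le_D1)
  also have "\<dots> = (\<Sum>i\<in>{m..<n}. L * \<bar>y i - a\<bar>) + (\<Sum>i\<in>{m..<n}. L * \<bar>y (i+1) - a\<bar>)"
    by (rule sum.distrib)
  also have "(\<Sum>i\<in>{m..<n}. L * \<bar>y i - a\<bar>) = (\<Sum>i\<in>{m}. L * \<bar>y i - a\<bar>)"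
    by (rule sum.mono_neutral_right) (use mn y in auto)
  also have "(\<Sum>i\<in>{m..<n}. L * \<bar>y (i+1) - a\<bar>) = (\<Sum>i\<in>{n-1}. L * \<bar>y (i+1) - a\<bar>)"
    by (rule sum.mono_neutral_right) (use mn y in auto)
  finally show ?thesis by simp
qed

text \<open>Passing to the maximum and the minimum with the constant configuration uncrosses the two in each step,
  which the twist condition rewards; the constant one has no excess energy.\<close>

lemma exc_max_min_le:
  assumes "h v v = c"
  shows "exc (\<lambda>i. max (y i) v) m n + exc (\<lambda>i. min (y i) v) m n \<le> exc y m n"
proof -
  have "h (max p v) (max q v) + h (min p v) (min q v) \<le> h p q + c" for p q
    using weak_twist[of v p q v] weak_twist[of p v v q] assms
    by (auto simp: max_def min_def)
  then have "(h (max p v) (max q v) - c) + (h (min p v) (min q v) - c) \<le> h p q - c" for p q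
    by (metis add_diff_eq diff_add_eq diff_le_eq add.commute diff_right_mono)
  then show ?thesis
    unfolding exc_def sum.distrib[symmetric] by (intro sum_mono)
qed

definition clip :: "config \<Rightarrow> config" where
  "clip y = (\<lambda>i. min (max (y i) u0) u1)"

lemma clip_strip: "clip y \<in> strip u0 u1"
  using less by (auto simp: clip_def strip_def)

text \<open>The part of \<open>y\<close> that clipping removes forms loops at a ground state, whose excess energy is
  nonnegative. Hence minimality within the strip is minimality among all configurations.\<close>

lemma exc_clip_le:
  assumes "m \<le> n" "y m \<in> {u0..u1}" "y n \<in> {u0..u1}"
  shows "exc (clip y) m n \<le> exc y m n"
proof -
  define z where "z i = max (y i) u0" for i
  have "exc z m n + exc (\<lambda>i. min (y i) u0) m n \<le> exc y m n"
    unfolding z_def by (rule exc_max_min_le[OF hu0])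
  moreover have "0 \<le> exc (\<lambda>i. min (y i) u0) m n"
    using exc_ge_dist[OF assms(1), of "\<lambda>i. min (y i) u0"] assms by (simp add: min_absorb2)
  moreover have "exc (\<lambda>i. max (z i) u1) m n + exc (\<lambda>i. min (z i) u1) m n \<le> exc z m n"
    by (rule exc_max_min_le[OF hu1])
  moreover have "0 \<le> exc (\<lambda>i. max (z i) u1) m n"
    using exc_ge_dist[OF assms(1), of "\<lambda>i. max (z i) u1"] assms less
    by (simp add: z_def max_absorb1 max_absorb2)
  ultimately show ?thesis by (simp add: clip_def z_def)
qed

end

section \<open>The Mane potential\<close>

lemma continuous_on_abs_le:
  fixes f :: "real \<Rightarrow> real"
  assumes "0 \<le> K" "\<And>x y. x \<in> S \<Longrightarrow> y \<in> S \<Longrightarrow> \<bar>f x - f y\<bar> \<le> K * \<bar>x - y\<bar>"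
  shows "continuous_on S f"
  by (rule lipschitz_on_continuous_on[of K], rule lipschitz_onI) (use assms in \<open>auto simp: dist_real_def\<close>)

context twist_strip
begin

text \<open>This is the Mane potential: the least excess energy for a transfer from \<open>a\<close> to \<open>b\<close> within
  the strip, in any number of steps.\<close>

definition pot :: "real \<Rightarrow> real \<Rightarrow> real" where
  "pot a b = Inf {exc x m n | x m n. m < n \<and> x \<in> strip u0 u1 \<and> x m = a \<and> x n = b}"

lemma strip_in: "x \<in> strip u0 u1 \<Longrightarrow> x i \<in> {u0..u1}"
  by (auto simp: strip_def)

lemma ends_in: "a \<in> {u0, u1} \<Longrightarrow> a \<in> {u0..u1}"
  using less by auto

lemma ends_c: "a \<in> {u0, u1} \<Longrightarrow> h a a = c"
  using hu0 hu1 by auto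

lemma pot_le:
  assumes "m < n" "x \<in> strip u0 u1"
  shows "pot (x m) (x n) \<le> exc x m n"
  unfolding pot_def
proof (rule cInf_lower)
  show "bdd_below {exc y k l | y k l. k < l \<and> y \<in> strip u0 u1 \<and> y k = x m \<and> y l = x n}"
  proof (rule bdd_belowI[of _ "- L * \<bar>x n - x m\<bar>"])
    fix z assume "z \<in> {exc y k l | y k l. k < l \<and> y \<in> strip u0 u1 \<and> y k = x m \<and> y l = x n}"
    then obtain y k l where "z = exc y k l" "k < l" "y k = x m" "y l = x n" by blast
    then show "- L * \<bar>x n - x m\<bar> \<le> z" using exc_ge_dist[of k l y] by simp
  qed
qed (use assms in blast)

lemma path_nonempty:
  assumes "a \<in> {u0..u1}" "b \<in> {u0..u1}"
  shows "{exc x m n | x m n. m < n \<and> x \<in> strip u0 u1 \<and> x m = a \<and> x n = b} \<noteq> {}"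
proof -
  have "(\<lambda>i::int. if i = 0 then a else b) \<in> strip u0 u1"
    using assms by (auto simp: strip_def)
  then have "exc (\<lambda>i. if i = 0 then a else b) 0 1 \<in>
      {exc x m n | x m n. m < n \<and> x \<in> strip u0 u1 \<and> x m = a \<and> x n = b}"
    by (smt (verit) mem_Collect_eq)
  then show ?thesis by blast
qed

lemma pot_greatest:
  assumes "a \<in> {u0..u1}" "b \<in> {u0..u1}"
    and "\<And>x m n. m < n \<Longrightarrow> x \<in> strip u0 u1 \<Longrightarrow> x m = a \<Longrightarrow> x n = b \<Longrightarrow> z \<le> exc x m n"
  shows "z \<le> pot a b"
  unfolding pot_def by (rule cInf_greatest[OF path_nonempty[OF assms(1,2)]]) (use assms(3) in auto)

lemma pot_ge: "a \<in> {u0..u1} \<Longrightarrow> b \<in> {u0..u1} \<Longrightarrow> - L * \<bar>b - a\<bar> \<le> pot a b"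
  by (rule pot_greatest) (use exc_ge_dist in fastforce)+

lemma pot_approx:
  assumes "a \<in> {u0..u1}" "b \<in> {u0..u1}" "0 < e"
  shows "\<exists>x N. 0 < N \<and> x \<in> strip u0 u1 \<and> x s = a \<and> x (s + N) = b \<and> exc x s (s + N) < pot a b + e"
proof -
  have "\<exists>z \<in> {exc x m n | x m n. m < n \<and> x \<in> strip u0 u1 \<and> x m = a \<and> x n = b}. z < pot a b + e"
  proof (rule ccontr)
    assume "\<not> ?thesis"
    then have "pot a b + e \<le> exc x m n"
      if "m < n" "x \<in> strip u0 u1" "x m = a" "x n = b" for x m n
      using that not_less by blast
    then have "pot a b + e \<le> pot a b"
      by (rule pot_greatest[OF assms(1,2)])
    then show False using assms by simp
  qed
  then obtain x m n where x: "m < n" "x \<in> strip u0 u1" "x m = a" "x n = b" "exc x m n < pot a b + e"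
    by blast
  let ?y = "\<lambda>i. x (i + (m - s))"
  have "exc ?y s (s + (n - m)) = exc x m n"
    by (simp add: exc_shift)
  then show ?thesis
    using x by (intro exI[of _ ?y] exI[of _ "n - m"]) (auto simp: strip_def)
qed

lemma path_join:
  assumes "x \<in> strip u0 u1" "y \<in> strip u0 u1" "x k = y k" "m \<le> k" "k \<le> n"
  obtains w where "w \<in> strip u0 u1" "w m = x m" "w k = x k" "w n = y n"
    "\<And>i. i \<le> k \<Longrightarrow> w i = x i" "\<And>i. k \<le> i \<Longrightarrow> w i = y i"
    "exc w m n = exc x m k + exc y k n"
proof -
  define w where "w i = (if i \<le> k then x i else y i)" for i
  have w1: "\<And>i. i \<le> k \<Longrightarrow> w i = x i" and w2: "\<And>i. k \<le> i \<Longrightarrow> w i = y i"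
    using assms by (auto simp: w_def)
  have "exc w m k = exc x m k" "exc w k n = exc y k n"
    using w1 w2 by (auto intro: exc_cong)
  moreover have "w \<in> strip u0 u1" using assms by (auto simp: w_def strip_def)
  ultimately show thesis
    using that[of w] exc_split[of m k n w] w1 w2 assms by auto
qed

lemma pot_triangle:
  assumes "a \<in> {u0..u1}" "b \<in> {u0..u1}" "d \<in> {u0..u1}"
  shows "pot a d \<le> pot a b + pot b d"
proof (rule field_le_epsilon)
  fix e :: real assume e: "0 < e"
  obtain x N where x: "0 < N" "x \<in> strip u0 u1" "x 0 = a" "x (0 + N) = b" "exc x 0 (0+N) < pot a b + e/2"
    using pot_approx[OF assms(1,2) half_gt_zero[OF e], of 0] by blast
  obtain y M where y: "0 < M" "y \<in> strip u0 u1" "y N = b" "y (N + M) = d" "exc y N (N+M) < pot b d + e/2"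
    using pot_approx[OF assms(2,3) half_gt_zero[OF e], of N] by blast
  obtain w where w: "w \<in> strip u0 u1" "w 0 = x 0" "w (N + M) = y (N+M)" "exc w 0 (N + M) = exc x 0 N + exc y N (N+M)"
    by (rule path_join[of x y N 0 "N+M"]) (use x y in auto)
  have "pot a d \<le> exc w 0 (N+M)"
    using pot_le[of 0 "N+M" w] w x y by simp
  then show "pot a d \<le> pot a b + pot b d + e" using w x y by simp
qed

lemma pot_le_step: "a \<in> {u0..u1} \<Longrightarrow> b \<in> {u0..u1} \<Longrightarrow> pot a b \<le> h a b - c"
  using pot_le[of 0 1 "\<lambda>i. if i = 0 then a else b"] exc_step[of "\<lambda>i. if i = 0 then a else b" 0]
  by (auto simp: strip_def)

lemma pot_end [simp]: "a \<in> {u0, u1} \<Longrightarrow> pot a a = 0"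
  using pot_ge[of a a] pot_le_step[of a a] ends_in[of a] ends_c[of a] by auto

lemma pot_lip2:
  assumes "a \<in> {u0..u1}" "b \<in> {u0..u1}" "b' \<in> {u0..u1}"
  shows "pot a b \<le> pot a b' + L * \<bar>b - b'\<bar>"
proof -
  have "pot a b - L * \<bar>b - b'\<bar> \<le> pot a b'"
  proof (rule pot_greatest[OF assms(1,3)])
    fix x m n assume x: "m < n" "x \<in> strip u0 u1" "x m = a" "x n = b'"
    let ?y = "x(n := b)"
    have "?y \<in> strip u0 u1" using x assms by (auto simp: strip_def)
    then have "pot a b \<le> exc ?y m n" using pot_le[of m n ?y] x by simp
    moreover have "exc ?y m (n-1) = exc x m (n-1)" by (rule exc_cong) auto
    ultimately show "pot a b - L * \<bar>b - b'\<bar> \<le> exc x m n"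
      using exc_last[OF x(1), of x] exc_last[OF x(1), of ?y] lip2[of "x (n-1)" b b'] x by simp
  qed
  then show ?thesis by simp
qed

lemma exc_first: "m < n \<Longrightarrow> exc x m n = (h (x m) (x (m+1)) - c) + exc x (m+1) n"
  using exc_split[of m "m+1" n x] exc_step[of x m] by simp

lemma pot_lip1:
  assumes "a \<in> {u0..u1}" "a' \<in> {u0..u1}" "b \<in> {u0..u1}"
  shows "pot a b \<le> pot a' b + L * \<bar>a - a'\<bar>"
proof -
  have "pot a b - L * \<bar>a - a'\<bar> \<le> pot a' b"
  proof (rule pot_greatest[OF assms(2,3)])
    fix x m n assume x: "m < n" "x \<in> strip u0 u1" "x m = a'" "x n = b"
    let ?y = "x(m := a)"
    have "?y \<in> strip u0 u1" using x assms by (auto simp: strip_def)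
    then have "pot a b \<le> exc ?y m n" using pot_le[of m n ?y] x by simp
    moreover have "exc ?y (m+1) n = exc x (m+1) n" by (rule exc_cong) auto
    ultimately show "pot a b - L * \<bar>a - a'\<bar> \<le> exc x m n"
      using exc_first[OF x(1), of x] exc_first[OF x(1), of ?y] lip1[of a "x (m+1)" a'] x by simp
  qed
  then show ?thesis by simp
qed

lemma continuous_pot2: "a \<in> {u0..u1} \<Longrightarrow> continuous_on {u0..u1} (pot a)"
  using pot_lip2[of a] Lpos
  by (intro continuous_on_abs_le[of L]) (auto simp: abs_le_iff algebra_simps abs_minus_commute, smt (verit))

lemma continuous_pot1: "b \<in> {u0..u1} \<Longrightarrow> continuous_on {u0..u1} (\<lambda>a. pot a b)"
  using pot_lip1[of _ _ b] Lpos
  by (intro continuous_on_abs_le[of L]) (auto simp: abs_le_iff algebra_simps abs_minus_commute, smt (verit))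

lemma continuous_h_left: "continuous_on S (\<lambda>v. h v b)"
  by (rule continuous_on_abs_le[of L]) (use lip1 Lpos in auto)

lemma continuous_diag: "continuous_on S (\<lambda>v. h v v)"
proof (rule continuous_on_abs_le[of "2 * L"])
  fix x y
  show "\<bar>h x x - h y y\<bar> \<le> 2 * L * \<bar>x - y\<bar>"
    using lip1[of x x y] lip2[of y x y] by linarith
qed (use Lpos in auto)

text \<open>The part of the strip at distance at least \<open>d\<close> from both ground states is compact, and the
  diagonal energy exceeds \<open>c\<close> there.\<close>

lemma near_ends:
  assumes "0 < d"
  obtains \<mu> where "0 < \<mu>"
    "\<And>v. v \<in> {u0..u1} \<Longrightarrow> h v v - c < \<mu> \<Longrightarrow> \<bar>v - u0\<bar> < d \<or> \<bar>v - u1\<bar> < d"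
proof (cases "u0 + d \<le> u1 - d")
  case True
  then obtain v where v: "v \<in> {u0+d..u1-d}" "\<And>w. w \<in> {u0+d..u1-d} \<Longrightarrow> h v v \<le> h w w"
    using continuous_attains_inf[of "{u0+d..u1-d}", OF _ _ continuous_diag] by auto
  have "0 < h v v - c" using pos[of v] v assms by auto
  moreover have "\<bar>w - u0\<bar> < d \<or> \<bar>w - u1\<bar> < d" if "w \<in> {u0..u1}" "h w w - c < h v v - c" for w
    using v(2)[of w] that by fastforce
  ultimately show thesis by (rule that)
next
  case False
  show thesis by (rule that[of 1]) (use False in auto)
qed

text \<open>Some step of the path leaves the half of the strip around \<open>a\<close>. If the diagonal energy of the path is
  small, all its points are near the ground states, so this step starts near \<open>a\<close> and
  ends near \<open>b\<close>. It costs nearly as much as the direct jump, and the two remaining pieces of the path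
  cannot gain more than a multiple of \<open>d\<close>.\<close>

lemma heteroclinic_path_dichotomy:
  assumes ab: "{a, b} = {u0, u1}" and d: "0 < d" "2 * d \<le> u1 - u0"
    and \<mu>: "\<And>v. v \<in> {u0..u1} \<Longrightarrow> h v v - c < \<mu> \<Longrightarrow> \<bar>v - u0\<bar> < d \<or> \<bar>v - u1\<bar> < d"
    and x: "x \<in> strip u0 u1" "m < n" "x m = a" "x n = b"
  shows "h a b - c - 4 * L * d \<le> exc x m n \<or> \<mu> \<le> (\<Sum>i\<in>{m..<n}. h (x i) (x i) - c)"
proof (rule disjCI)
  assume "\<not> \<mu> \<le> (\<Sum>i\<in>{m..<n}. h (x i) (x i) - c)"
  then have s: "(\<Sum>i\<in>{m..<n}. h (x i) (x i) - c) < \<mu>" by simp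
  have nearx: "\<bar>x i - u0\<bar> < d \<or> \<bar>x i - u1\<bar> < d" if "m \<le> i" "i < n" for i
  proof (rule \<mu>)
    have "h (x i) (x i) - c \<le> (\<Sum>i\<in>{m..<n}. h (x i) (x i) - c)"
      using that diag by (intro member_le_sum) auto
    then show "h (x i) (x i) - c < \<mu>" using s by simp
  qed (use strip_in[OF x(1)] in auto)
  obtain i where i: "m \<le> i" "i < n" "\<bar>x i - a\<bar> \<le> (u1 - u0)/2" "\<not> \<bar>x (i+1) - a\<bar> \<le> (u1 - u0)/2"
    using transition_exists[of m n "\<lambda>i. \<bar>x i - a\<bar> \<le> (u1 - u0)/2"] x ab less
    by (force simp: doubleton_eq_iff)
  have 1: "\<bar>x i - a\<bar> < d"
    using nearx[OF i(1,2)] i(3) d ab by (auto simp: doubleton_eq_iff)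
  have 2: "\<bar>x (i+1) - b\<bar> < d"
  proof (cases "i + 1 = n")
    case True then show ?thesis using x d by simp
  next
    case False
    then have "\<bar>x (i+1) - u0\<bar> < d \<or> \<bar>x (i+1) - u1\<bar> < d" using nearx[of "i+1"] i by simp
    then show ?thesis using i(4) d ab by (auto simp: doubleton_eq_iff)
  qed
  have e: "exc x m n = exc x m i + (h (x i) (x (i+1)) - c) + exc x (i+1) n"
    using exc_split[of m i n x] exc_first[of i n x] i by simp
  have "- L * \<bar>x i - a\<bar> \<le> exc x m i" "- L * \<bar>x (i+1) - b\<bar> \<le> exc x (i+1) n"
    using exc_ge_dist[of m i x] exc_ge_dist[of "i+1" n x] i x by (auto simp: abs_minus_commute)
  moreover have "h a b - h (x i) (x (i+1)) \<le> L * \<bar>x i - a\<bar> + L * \<bar>x (i+1) - b\<bar>"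
    using lip1[of a b "x i"] lip2[of "x i" b "x (i+1)"] by (simp add: abs_minus_commute)
  moreover have "L * \<bar>x i - a\<bar> \<le> L * d" "L * \<bar>x (i+1) - b\<bar> \<le> L * d"
    using 1 2 Lpos by auto
  ultimately show "h a b - c - 4 * L * d \<le> exc x m n" using e by linarith
qed

text \<open>A round trip is a loop, so its excess energy bounds its diagonal energy. If the latter is small, both
  halves of the trip contain almost direct jumps, and the direct jumps \<open>u0\<close> to \<open>u1\<close> and back have positive
  total cost by the twist condition.\<close>

lemma round_trip_pos: "0 < pot u0 u1 + pot u1 u0"
proof -
  define G where "G = h u0 u1 + h u1 u0 - 2 * c"
  have G: "0 < G" using twist[of u0 u1 u0 u1] less hu0 hu1 by (simp add: G_def)
  define d where "d = min ((u1 - u0)/2) (G / (16 * L))"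
  have d: "0 < d" "2 * d \<le> u1 - u0" using less G Lpos min.cobounded1[of "(u1 - u0)/2" "G / (16 * L)"] by (auto simp: d_def)
  have "d \<le> G / (16 * L)" by (simp add: d_def)
  then have dG: "16 * L * d \<le> G" using Lpos by (simp add: field_simps)
  obtain \<mu> where \<mu>: "0 < \<mu>" 
    "\<And>v. v \<in> {u0..u1} \<Longrightarrow> h v v - c < \<mu> \<Longrightarrow> \<bar>v - u0\<bar> < d \<or> \<bar>v - u1\<bar> < d"
    using near_ends[OF d(1)] by blast
  define E where "E = min \<mu> (G/2)"
  have E: "0 < E" using \<mu> G by (simp add: E_def)
  have in01: "u0 \<in> {u0..u1}" "u1 \<in> {u0..u1}" using less by auto
  show ?thesis
  proof (rule ccontr)
    assume neg: "\<not> ?thesis"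
    obtain x N where x: "0 < N" "x \<in> strip u0 u1" "x 0 = u0" "x (0 + N) = u1" "exc x 0 (0+N) < pot u0 u1 + E/2"
      using pot_approx[OF in01 half_gt_zero[OF E], of 0] by blast
    obtain y M where y: "0 < M" "y \<in> strip u0 u1" "y N = u1" "y (N + M) = u0" "exc y N (N+M) < pot u1 u0 + E/2"
      using pot_approx[OF in01(2,1) half_gt_zero[OF E], of N] by blast
    obtain w where w: "w \<in> strip u0 u1" "w 0 = x 0" "w (N + M) = y (N+M)"
      "\<And>i. i \<le> N \<Longrightarrow> w i = x i" "\<And>i. N \<le> i \<Longrightarrow> w i = y i"
      "exc w 0 (N + M) = exc x 0 N + exc y N (N+M)"
      by (rule path_join[of x y N 0 "N+M"]) (use x y in auto)
    have "(\<Sum>i\<in>{0..<N}. h (w i) (w i) - c) + (\<Sum>i\<in>{N..<N+M}. h (w i) (w i) - c)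
        = (\<Sum>i\<in>{0..<N+M}. h (w i) (w i) - c)"
      using x y by (subst sum.union_disjoint[symmetric]) (auto simp: ivl_disj_un)
    also have "\<dots> \<le> exc w 0 (N+M)" using exc_ge[of 0 "N+M" w] x y w by simp
    finally have s: "(\<Sum>i\<in>{0..<N}. h (w i) (w i) - c) + (\<Sum>i\<in>{N..<N+M}. h (w i) (w i) - c) < E"
      using x y w neg by simp
    have "0 \<le> (\<Sum>i\<in>{0..<N}. h (w i) (w i) - c)" "0 \<le> (\<Sum>i\<in>{N..<N+M}. h (w i) (w i) - c)"
      using diag by (auto intro!: sum_nonneg)
    then have "(\<Sum>i\<in>{0..<N}. h (w i) (w i) - c) < \<mu>" "(\<Sum>i\<in>{N..<N+M}. h (w i) (w i) - c) < \<mu>"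
      using s by (auto simp: E_def)
    then have "h u0 u1 - c - 4 * L * d \<le> exc w 0 N" "h u1 u0 - c - 4 * L * d \<le> exc w N (N+M)"
      using heteroclinic_path_dichotomy[of u0 u1 d \<mu> w 0 N] heteroclinic_path_dichotomy[of u1 u0 d \<mu> w N "N+M"]
        w x y d \<mu> by auto
    then have "G - 8 * L * d \<le> exc w 0 (N+M)"
      using exc_split[of 0 N "N+M" w] x y by (simp add: G_def)
    then have "G / 2 \<le> exc w 0 (N+M)" using dG by simp
    then show False using x y w neg E_def by simp
  qed
qed

text \<open>Waiting at the target is free, so a near-optimal transition can be extended to every larger length.\<close>

lemma long_transition:
  assumes a: "a \<in> {u0, u1}" and b: "b \<in> {u0, u1}" and e: "0 < e"
  obtains N where "\<And>s n. N \<le> n \<Longrightarrow> \<exists>z\<in>strip u0 u1. z s = a \<and> z (s + n) = b \<and> exc z s (s + n) < pot a b + e"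
proof -
  obtain x N where x: "0 < N" "x \<in> strip u0 u1" "x 0 = a" "x (0 + N) = b" "exc x 0 (0+N) < pot a b + e"
    using pot_approx[OF ends_in[OF a] ends_in[OF b] e, of 0] by blast
  have "\<exists>z\<in>strip u0 u1. z s = a \<and> z (s + n) = b \<and> exc z s (s + n) < pot a b + e" if nN: "N \<le> n" for s n
  proof -
    obtain w where w: "w \<in> strip u0 u1" "w 0 = x 0" "w n = b" "exc w 0 n = exc x 0 N + exc (\<lambda>_. b) N n"
      by (rule path_join[of x "\<lambda>_. b" N 0 n]) (use x ends_in[OF b] nN in \<open>auto simp: strip_def\<close>)
    have "exc (\<lambda>_. b) N n = 0" using ends_c[OF b] by (simp add: exc_def)
    then have "exc w 0 n < pot a b + e" using w x by simp
    moreover have "exc (\<lambda>i. w (i + (- s))) s (s + n) = exc w 0 n"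
      unfolding exc_shift by simp
    ultimately show ?thesis
      using w x by (intro bexI[of _ "\<lambda>i. w (i + (- s))"]) (auto simp: strip_def)
  qed
  then show thesis using that by blast
qed

end

section \<open>Optimal transitions and their gaps\<close>

lemma mono_int_step:
  fixes x :: "int \<Rightarrow> real"
  assumes "\<And>i. x i \<le> x (i + 1)"
  shows "mono x"
proof (rule monoI)
  fix i j :: int assume "i \<le> j"
  then show "x i \<le> x j"
  proof (induction j rule: int_ge_induct)
    case (step j)
    then show ?case using assms[of j] by linarith
  qed simp
qed

lemma mono_int_limits:
  fixes x :: "int \<Rightarrow> real"
  assumes "mono x" "\<And>i. A \<le> x i" "\<And>i. x i \<le> B"
  obtains l r where "(x \<longlongrightarrow> l) at_bot" "(x \<longlongrightarrow> r) at_top" "\<And>i. l \<le> x i" "\<And>i. x i \<le> r"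
proof -
  have bdd: "bdd_above (range x)" "bdd_below (range x)"
    using assms by (auto intro: bdd_aboveI2[of _ _ B] bdd_belowI2[of _ A])
  have up: "x i \<le> (SUP i. x i)" and lo: "(INF i. x i) \<le> x i" for i
    using bdd by (auto intro: cSUP_upper cINF_lower)
  have "(x \<longlongrightarrow> (SUP i. x i)) at_top"
  proof (rule order_tendstoI)
    fix y assume "y < (SUP i. x i)"
    then obtain n where "y < x n" using less_cSUP_iff[OF _ bdd(1)] by auto
    then show "\<forall>\<^sub>F i in at_top. y < x i"
      unfolding eventually_at_top_linorder using monoD[OF assms(1)] by (intro exI[of _ n]) (auto intro: less_le_trans)
  next
    fix y assume "(SUP i. x i) < y"
    then show "\<forall>\<^sub>F i in at_top. x i < y" by (intro always_eventually allI le_less_trans[OF up])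
  qed
  moreover have "(x \<longlongrightarrow> (INF i. x i)) at_bot"
  proof (rule order_tendstoI)
    fix y assume "(INF i. x i) < y"
    then obtain n where "x n < y" using cINF_less_iff[OF _ bdd(2)] by auto
    then show "\<forall>\<^sub>F i in at_bot. x i < y"
      unfolding eventually_at_bot_linorder using monoD[OF assms(1)] by (intro exI[of _ n]) (auto intro: le_less_trans)
  next
    fix y assume "y < (INF i. x i)"
    then show "\<forall>\<^sub>F i in at_bot. y < x i" by (intro always_eventually allI less_le_trans[OF _ lo])
  qed
  ultimately show thesis using that up lo by blast
qed

lemma strip_rotation_number:
  assumes "x \<in> strip u0 u1"
  shows "has_rotation_number x 0"
proof -
  define K where "K = max \<bar>u0\<bar> \<bar>u1\<bar>"
  have K: "\<bar>x i\<bar> \<le> K" for i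
  proof -
    have "u0 \<le> x i" "x i \<le> u1" using assms by (auto simp: strip_def)
    then show ?thesis unfolding K_def by linarith
  qed
  have le: "norm (x i / of_int i) \<le> norm (K / of_int i)" for i
    using K[of i] by (simp add: divide_right_mono)
  have "((\<lambda>i. K / of_int i) \<longlongrightarrow> 0) (at_top :: int filter)"
    by (intro tendsto_divide_0[OF tendsto_const] filterlim_at_top_imp_at_infinity filterlim_real_of_int_at_top)
  moreover have "((\<lambda>i. K / of_int i) \<longlongrightarrow> 0) (at_bot :: int filter)"
  proof -
    have "filterlim (\<lambda>i::int. real_of_int i) at_bot at_bot"
      unfolding filterlim_at_bot eventually_at_bot_linorder
    proof
      fix Z :: real
      show "\<exists>N. \<forall>n\<le>N. real_of_int n \<le> Z"
        by (intro exI[of _ "\<lfloor>Z\<rfloor>"]) linarith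
    qed
    then show ?thesis
      by (intro tendsto_divide_0[OF tendsto_const] filterlim_at_bot_imp_at_infinity)
  qed
  moreover have "((\<lambda>i. x i / of_int i) \<longlongrightarrow> 0) F" if "((\<lambda>i. K / of_int i) \<longlongrightarrow> 0) F" for F
    by (rule Lim_null_comparison[OF _ tendsto_norm_zero[OF that]], rule always_eventually, rule allI, rule le)
  ultimately show ?thesis
    by (simp add: has_rotation_number_def)
qed

context twist_strip
begin

lemma tendsto_h:
  assumes "(f \<longlongrightarrow> p) F" "(g \<longlongrightarrow> q) F"
  shows "((\<lambda>i. h (f i) (g i)) \<longlongrightarrow> h p q) F"
proof (rule Lim_transform2[OF tendsto_const])
  have "((\<lambda>i. L * \<bar>f i - p\<bar> + L * \<bar>g i - q\<bar>) \<longlongrightarrow> L * \<bar>p - p\<bar> + L * \<bar>q - q\<bar>) F"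
    by (intro tendsto_intros assms)
  then have lim: "((\<lambda>i. L * \<bar>f i - p\<bar> + L * \<bar>g i - q\<bar>) \<longlongrightarrow> 0) F"
    by simp
  have le: "norm (h p q - h (f i) (g i)) \<le> L * \<bar>f i - p\<bar> + L * \<bar>g i - q\<bar>" for i
    using lip1[of p q "f i"] lip2[of "f i" q "g i"] by (simp add: abs_minus_commute)
  show "((\<lambda>i. h p q - h (f i) (g i)) \<longlongrightarrow> 0) F"
    by (rule Lim_null_comparison[OF _ lim], rule always_eventually, rule allI, rule le)
qed

lemma transposed: "twist_strip (\<lambda>x y. h y x) u0 u1 L c"
proof unfold_locales
  show "\<bar>h y x - h y x'\<bar> \<le> L * \<bar>x - x'\<bar>" for x x' y by (rule lip2)
  show "\<bar>h y x - h y' x\<bar> \<le> L * \<bar>y - y'\<bar>" for x y y' by (rule lip1)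
  show "h y x + h y' x' < h y' x + h y x'" if "x < x'" "y < y'" for x x' y y'
    using twist[OF that(2,1)] by simp
  show "(p - p') * (r - r') < 0"
    if "\<And>t. h q p + h r q \<le> h t p + h r t" "\<And>t. h q p' + h r' q \<le> h t p' + h r' t" "(p, r) \<noteq> (p', r')"
    for p p' q r r'
    using triple[of r q p r' p'] that by (auto simp: mult.commute add.commute)
qed (use less Lpos diag hu0 hu1 pos in auto)

lemma transposed_exc:
  "twist_strip.exc (\<lambda>x y. h y x) c x m n = exc (\<lambda>i. x (- i)) (- n) (- m)"
  unfolding exc_def twist_strip.exc_def[OF transposed]
  by (rule sum.reindex_bij_witness[of _ "\<lambda>i. - i - 1" "\<lambda>i. - i - 1"]) (auto simp: algebra_simps)

text \<open>Reading a path backwards is a path for the transposed function.\<close>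

lemma transposed_pot:
  assumes "a \<in> {u0..u1}" "b \<in> {u0..u1}"
  shows "twist_strip.pot (\<lambda>x y. h y x) u0 u1 c a b = pot b a"
proof -
  interpret T: twist_strip "\<lambda>x y. h y x" u0 u1 L c by (rule transposed)
  have rs: "(\<lambda>i. x (- i)) \<in> strip u0 u1" if "x \<in> strip u0 u1" for x :: config
    using that by (auto simp: strip_def)
  have "pot b a \<le> T.pot a b"
  proof (rule T.pot_greatest[OF assms])
    fix x m n assume "m < (n::int)" "x \<in> strip u0 u1" "x m = a" "x n = b"
    then show "pot b a \<le> T.exc x m n"
      using pot_le[of "-n" "-m" "\<lambda>i. x (- i)"] rs by (simp add: transposed_exc)
  qed
  moreover have "T.pot a b \<le> pot b a"
  proof (rule pot_greatest[OF assms(2,1)])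
    fix x m n assume "m < (n::int)" "x \<in> strip u0 u1" "x m = b" "x n = a"
    then show "T.pot a b \<le> exc x m n"
      using T.pot_le[of "-n" "-m" "\<lambda>i. x (- i)"] rs by (simp add: transposed_exc)
  qed
  ultimately show ?thesis by simp
qed

text \<open>The detour through a point \<open>z\<close> of this set is free: these are the points of optimal transitions from
  \<open>a\<close> to \<open>b\<close>.\<close>

definition crit :: "real \<Rightarrow> real \<Rightarrow> real set" where
  "crit a b = {z \<in> {u0..u1}. pot a z + pot z b = pot a b}"

text \<open>A single step of an optimal transition. Because both points are critical, the equation is equivalent to
  \<open>pot q b = h q z - c + pot z b\<close>, so the relation is compatible with time reversal.\<close>

definition link :: "real \<Rightarrow> real \<Rightarrow> real \<Rightarrow> real \<Rightarrow> bool" where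
  "link a b q z \<longleftrightarrow> q \<in> crit a b \<and> z \<in> crit a b \<and> pot a z = pot a q + h q z - c"

lemma crit_in: "z \<in> crit a b \<Longrightarrow> z \<in> {u0..u1}"
  by (auto simp: crit_def)

context
  fixes a b
  assumes ab: "{a, b} = {u0, u1}"
begin

lemma a_end: "a \<in> {u0, u1}" and b_end: "b \<in> {u0, u1}"
  using ab by auto

lemma ab_in: "a \<in> {u0..u1}" "b \<in> {u0..u1}"
  using a_end b_end ends_in by auto

lemma ends_crit: "a \<in> crit a b" "b \<in> crit a b"
  using a_end b_end ab_in by (auto simp: crit_def)

lemma transposed_crit: "twist_strip.crit (\<lambda>x y. h y x) u0 u1 c b a = crit a b"
  unfolding crit_def twist_strip.crit_def[OF transposed]
  using ab_in by (auto simp: transposed_pot add.commute)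

lemma transposed_link:
  "twist_strip.link (\<lambda>x y. h y x) u0 u1 c b a z q \<longleftrightarrow> link a b q z"
  unfolding link_def twist_strip.link_def[OF transposed] transposed_crit
  using ab_in by (auto simp: transposed_pot crit_def)

text \<open>A path to \<open>z\<close> is a path to its last but one point followed by one step. The best last step exists by
  compactness, and its starting point is again critical by the triangle inequality.\<close>

lemma link_pred:
  assumes z: "z \<in> crit a b"
  shows "\<exists>q. link a b q z"
proof -
  have zi: "z \<in> {u0..u1}" using z by (rule crit_in)
  have "continuous_on {u0..u1} (\<lambda>q. pot a q + h q z - c)"
    by (intro continuous_intros continuous_pot2 continuous_h_left ab_in)
  then obtain q where q: "q \<in> {u0..u1}"
    "\<And>q'. q' \<in> {u0..u1} \<Longrightarrow> pot a q + h q z - c \<le> pot a q' + h q' z - c"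
    using continuous_attains_inf[of "{u0..u1}" "\<lambda>q. pot a q + h q z - c"] less by auto
  have "pot a q + h q z - c \<le> pot a z"
  proof (rule pot_greatest[OF ab_in(1) zi])
    fix x m n assume x: "m < n" "x \<in> strip u0 u1" "x m = a" "x n = z"
    have "pot a (x (n-1)) \<le> exc x m (n-1)"
    proof (cases "m = n - 1")
      case True then show ?thesis using x a_end by simp
    next
      case False then show ?thesis using pot_le[of m "n-1" x] x by simp
    qed
    then show "pot a q + h q z - c \<le> exc x m n"
      using q(2)[OF strip_in[OF x(2), of "n-1"]] exc_last[OF x(1), of x] x by simp
  qed
  moreover have "pot a z \<le> pot a q + (h q z - c)"
    using pot_triangle[OF ab_in(1) q(1) zi] pot_le_step[OF q(1) zi] by simp
  ultimately have eq: "pot a z = pot a q + h q z - c" by simp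
  have "pot a q + pot q b \<le> pot a b"
    using pot_triangle[OF q(1) zi ab_in(2)] pot_le_step[OF q(1) zi] eq z by (simp add: crit_def)
  then have "q \<in> crit a b"
    using pot_triangle[OF ab_in(1) q(1) ab_in(2)] q by (simp add: crit_def)
  then show ?thesis using eq z by (auto simp: link_def)
qed

text \<open>Along links the potential from \<open>a\<close> telescopes, so linked segments realize potential differences.\<close>

lemma link_exc:
  assumes "m \<le> n" "\<And>i. m \<le> i \<Longrightarrow> i < n \<Longrightarrow> link a b (x i) (x (i+1))"
  shows "pot a (x n) = pot a (x m) + exc x m n"
  using assms
proof (induction n rule: int_ge_induct)
  case (step n)
  then have "link a b (x n) (x (n+1))" "pot a (x n) = pot a (x m) + exc x m n" by auto
  then show ?case
    using exc_last[of m "n+1" x] step by (simp add: link_def)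
qed simp

lemma link_minimal:
  assumes mn: "m < n" and l: "\<And>i. m \<le> i \<Longrightarrow> i < n \<Longrightarrow> link a b (x i) (x (i+1))"
    and y: "y m = x m" "y n = x n"
  shows "exc x m n \<le> exc y m n"
proof -
  have xi: "x m \<in> {u0..u1}" "x n \<in> {u0..u1}"
    using l[of m] l[of "n-1"] mn by (auto simp: link_def crit_def)
  have "clip y m = x m" "clip y n = x n" using y xi by (auto simp: clip_def)
  then have "pot (x m) (x n) \<le> exc (clip y) m n"
    using pot_le[OF mn clip_strip, of y] by simp
  also have "\<dots> \<le> exc y m n"
    by (rule exc_clip_le) (use mn xi y in auto)
  finally have "pot (x m) (x n) \<le> exc y m n" .
  then show ?thesis
    using pot_triangle[OF ab_in(1) xi] link_exc[of m n x] l mn by simp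
qed

lemma link_triple:
  assumes "link a b q z" "link a b z w"
  shows "h q z + h z w \<le> h q t + h t w"
proof -
  let ?x = "\<lambda>r i::int. if i = 0 then q else if i = 1 then r else w"
  have e: "exc (?x r) 0 2 = h q r + h r w - 2 * c" for r
    using exc_first[of 0 2 "?x r"] exc_first[of 1 2 "?x r"] by simp
  have "exc (?x z) 0 2 \<le> exc (?x t) 0 2"
  proof (rule link_minimal)
    fix i :: int assume "0 \<le> i" "i < 2"
    then have "i = 0 \<or> i = 1" by auto
    then show "link a b (?x z i) (?x z (i + 1))" using assms by auto
  qed auto
  then show ?thesis by (simp add: e)
qed

end

lemma link_succ:
  assumes ab: "{a, b} = {u0, u1}" and z: "z \<in> crit a b"
  shows "\<exists>w. link a b z w"
proof -
  interpret T: twist_strip "\<lambda>x y. h y x" u0 u1 L c by (rule transposed)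
  have "{b, a} = {u0, u1}" using ab by auto
  from T.link_pred[OF this, of z] show ?thesis
    using z transposed_crit[OF ab] transposed_link[OF ab] by metis
qed

context
  fixes a b
  assumes ab: "{a, b} = {u0, u1}"
begin

text \<open>Two predecessors of \<open>z\<close> would give, with a common successor, two minimal triples that share two
  consecutive entries, which the crossing condition forbids.\<close>

lemma link_unique_pred:
  assumes "link a b q z" "link a b q' z"
  shows "q = q'"
proof (rule ccontr)
  assume "q \<noteq> q'"
  obtain w where w: "link a b z w" using link_succ[OF ab, of z] assms(1) by (auto simp: link_def)
  have "(q - q') * (w - w) < 0"
    by (rule triple[of q z w q' w]) (use link_triple[OF ab _ w] assms \<open>q \<noteq> q'\<close> in auto)
  then show False by simp
qed

lemma link_unique_succ:
  assumes "link a b z w" "link a b z w'"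
  shows "w = w'"
proof (rule ccontr)
  assume "w \<noteq> w'"
  obtain q where q: "link a b q z" using link_pred[OF ab, of z] assms(1) by (auto simp: link_def)
  have "(q - q) * (w - w') < 0"
    by (rule triple[of q z w q w']) (use link_triple[OF ab q] assms \<open>w \<noteq> w'\<close> in auto)
  then show False by simp
qed

text \<open>If the predecessors were in the opposite order, exchanging them would lower the total cost of reaching
  \<open>z\<close> and \<open>z'\<close>.\<close>

lemma link_mono_pred:
  assumes l: "link a b q z" "link a b q' z'" and "z < z'"
  shows "q < q'"
proof (rule ccontr)
  assume "\<not> q < q'"
  moreover have "q \<noteq> q'" using link_unique_succ l \<open>z < z'\<close> by auto
  ultimately have "q' < q" by simp
  then have tw: "h q' z + h q z' < h q' z' + h q z" by (rule twist[OF _ \<open>z < z'\<close>])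
  have i: "q \<in> {u0..u1}" "q' \<in> {u0..u1}" "z \<in> {u0..u1}" "z' \<in> {u0..u1}"
    using l by (auto simp: link_def crit_def)
  have "pot a z \<le> pot a q' + (h q' z - c)" "pot a z' \<le> pot a q + (h q z' - c)"
    using pot_triangle[OF ab_in(1)[OF ab] i(2,3)] pot_triangle[OF ab_in(1)[OF ab] i(1,4)]
      pot_le_step[OF i(2,3)] pot_le_step[OF i(1,4)] by auto
  then show False using l tw by (simp add: link_def)
qed

lemma link_mono_succ:
  assumes l: "link a b q z" "link a b q' z'" and "q < q'"
  shows "z < z'"
  using link_mono_pred[OF l(2,1)] link_unique_pred[of q z q'] l \<open>q < q'\<close>
  by (metis less_asym neqE)

definition orbit :: "config \<Rightarrow> bool" where
  "orbit x \<longleftrightarrow> (\<forall>i. link a b (x i) (x (i + 1)))"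

lemma orbit_crit: "orbit x \<Longrightarrow> x i \<in> crit a b"
  by (auto simp: orbit_def link_def)

lemma orbit_strip: "orbit x \<Longrightarrow> x \<in> strip u0 u1"
  using orbit_crit crit_in by (fastforce simp: strip_def)

lemma orbit_exists:
  assumes z: "z \<in> crit a b"
  obtains x where "orbit x" "x 0 = z"
proof -
  define P where "P y = (SOME q. link a b q y)" for y
  define S where "S y = (SOME w. link a b y w)" for y
  have P: "link a b (P y) y" if "y \<in> crit a b" for y
    unfolding P_def using link_pred[OF ab that] by (rule someI_ex)
  have S: "link a b y (S y)" if "y \<in> crit a b" for y
    unfolding S_def using link_succ[OF ab that] by (rule someI_ex)
  have Pn: "(P ^^ n) z \<in> crit a b" for n
    by (induction n) (use z P link_def in auto)
  have Sn: "(S ^^ n) z \<in> crit a b" for n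
    by (induction n) (use z S link_def in auto)
  define x where "x i = (if 0 \<le> i then (S ^^ nat i) z else (P ^^ nat (- i)) z)" for i
  have "link a b (x i) (x (i + 1))" for i
  proof (cases "0 \<le> i")
    case True
    then show ?thesis using S[OF Sn, of "nat i"] by (simp add: x_def nat_add_distrib)
  next
    case False
    then have "nat (- i) = Suc (nat (- (i + 1)))" by simp
    then have "x i = P (x (i + 1))" using False by (auto simp: x_def)
    moreover have "x (i + 1) \<in> crit a b" using Sn Pn by (simp add: x_def)
    ultimately show ?thesis using P by simp
  qed
  then show thesis using that[of x] by (simp add: orbit_def x_def)
qed

lemma orbit_less:
  assumes "orbit x" "orbit y" "x 0 < y 0"
  shows "x i < y i"
proof (induction i rule: int_induct[where k = 0])
  case base then show ?case by fact
next
  case (step1 i)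
  then show ?case
    using link_mono_succ[of "x i" "x (i+1)" "y i" "y (i+1)"] assms(1,2) by (simp add: orbit_def)
next
  case (step2 i)
  then show ?case
    using link_mono_pred[of "x (i-1)" "x i" "y (i-1)" "y i"] assms(1,2)[unfolded orbit_def, rule_format, of "i-1"] by simp
qed

lemma orbit_shift: "orbit x \<Longrightarrow> orbit (\<lambda>i. x (i + s))"
  unfolding orbit_def by (metis add.assoc add.commute)

text \<open>In the limit the link becomes a link from \<open>l\<close> to itself, so resting at \<open>l\<close> costs nothing.\<close>

lemma orbit_limit_end:
  assumes o: "orbit x" and l: "(x \<longlongrightarrow> l) F" and l': "((\<lambda>i. x (i + 1)) \<longlongrightarrow> l) F" and F: "F \<noteq> bot"
  shows "l \<in> {u0, u1}"
proof -
  have xi: "x i \<in> {u0..u1}" for i by (rule crit_in[OF orbit_crit[OF o]])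
  have ev: "\<forall>\<^sub>F i in F. x i \<in> {u0..u1}" "\<forall>\<^sub>F i in F. x (i + 1) \<in> {u0..u1}"
    by (rule always_eventually, rule allI, rule xi)+
  have li: "l \<in> {u0..u1}"
    by (rule Lim_in_closed_set[OF closed_atLeastAtMost ev(1) F l])
  note cont = continuous_pot2[OF ab_in(1)[OF ab]]
  have p: "((\<lambda>i. pot a (x i)) \<longlongrightarrow> pot a l) F"
    by (rule continuous_on_tendsto_compose[OF cont l li ev(1)])
  have p': "((\<lambda>i. pot a (x (i+1))) \<longlongrightarrow> pot a l) F"
    by (rule continuous_on_tendsto_compose[OF cont l' li ev(2)])
  have t: "((\<lambda>i. pot a (x i) + h (x i) (x (i+1)) - c) \<longlongrightarrow> pot a l + h l l - c) F"
    by (rule tendsto_diff[OF tendsto_add[OF p tendsto_h[OF l l']] tendsto_const])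
  have eq: "(\<lambda>i. pot a (x i) + h (x i) (x (i+1)) - c) = (\<lambda>i. pot a (x (i+1)))"
  proof (rule ext)
    fix i
    have "link a b (x i) (x (i+1))" using o unfolding orbit_def by blast
    then show "pot a (x i) + h (x i) (x (i+1)) - c = pot a (x (i+1))" by (simp add: link_def)
  qed
  have "pot a l + h l l - c = pot a l"
    by (rule tendsto_unique[OF F t[unfolded eq] p'])
  then have "h l l = c" by simp
  then show ?thesis using pos[of l] li by (cases "u0 < l \<and> l < u1") auto
qed

text \<open>Comparing an orbit with its shift shows that it is strictly monotone, since links preserve the order
  and an orbit that stays at an interior point would have positive cost. So it converges to the two
  different ground states. Travelling from \<open>b\<close> to \<open>a\<close> is impossible: as the
  potential from \<open>a\<close> telescopes along the orbit, the round trip from \<open>a\<close> to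
  \<open>b\<close> and back would cost nothing.\<close>

lemma orbit_limits:
  assumes o: "orbit x" and x0: "u0 < x 0" "x 0 < u1"
  shows "(x \<longlongrightarrow> a) at_bot" "(x \<longlongrightarrow> b) at_top"
proof -
  have xi: "x i \<in> {u0..u1}" for i by (rule crit_in[OF orbit_crit[OF o]])
  have o1: "orbit (\<lambda>i. x (i + 1))" by (rule orbit_shift[OF o])
  have "x 0 \<noteq> x 1"
  proof
    assume "x 0 = x 1"
    then have "h (x 0) (x 0) = c" using o[unfolded orbit_def, rule_format, of 0] by (simp add: link_def)
    then show False using pos[OF x0] by simp
  qed
  then have "\<exists>l r. (x \<longlongrightarrow> l) at_bot \<and> (x \<longlongrightarrow> r) at_top \<and> l \<noteq> r"
  proof (cases "x 0 < x 1")
    case True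
    then have "x i < x (i + 1)" for i using orbit_less[OF o o1] by simp
    then have "mono x"
      by (intro mono_int_step less_imp_le)
    then obtain l r where lr: "(x \<longlongrightarrow> l) at_bot" "(x \<longlongrightarrow> r) at_top" "\<And>i. l \<le> x i" "\<And>i. x i \<le> r"
      using mono_int_limits[of x u0 u1] xi by auto
    moreover have "l \<noteq> r" using lr(3)[of 0] lr(4)[of 1] True by auto
    ultimately show ?thesis by blast
  next
    case False
    then have "x 1 < x 0" using \<open>x 0 \<noteq> x 1\<close> by simp
    then have "x (i + 1) < x i" for i using orbit_less[OF o1 o] by simp
    then have "- x i \<le> - x (i + 1)" for i by (simp add: less_imp_le)
    then have "mono (\<lambda>i. - x i)"
      by (rule mono_int_step)
    then obtain l r where lr: "((\<lambda>i. - x i) \<longlongrightarrow> l) at_bot" "((\<lambda>i. - x i) \<longlongrightarrow> r) at_top"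
      "\<And>i. l \<le> - x i" "\<And>i. - x i \<le> r"
      using mono_int_limits[of "\<lambda>i. - x i" "- u1" "- u0"] xi by auto
    moreover have "l \<noteq> r" using lr(3)[of 0] lr(4)[of 1] \<open>x 1 < x 0\<close> by force
    ultimately show ?thesis
      using tendsto_minus[OF lr(1)] tendsto_minus[OF lr(2)] by (intro exI[of _ "- l"] exI[of _ "- r"]) auto
  qed
  then obtain l r where l: "(x \<longlongrightarrow> l) at_bot" and r: "(x \<longlongrightarrow> r) at_top" and lr: "l \<noteq> r" by blast
  have "filterlim (\<lambda>i::int. i + 1) at_bot at_bot"
    unfolding filterlim_at_bot eventually_at_bot_linorder
  proof
    fix Z :: int
    show "\<exists>N. \<forall>n\<le>N. n + 1 \<le> Z"
      by (rule exI[of _ "Z - 1"]) auto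
  qed
  then have l': "((\<lambda>i. x (i + 1)) \<longlongrightarrow> l) at_bot"
    using filterlim_compose[OF l] by blast
  have "filterlim (\<lambda>i::int. i + 1) at_top at_top"
    unfolding filterlim_at_top eventually_at_top_linorder
  proof
    fix Z :: int
    show "\<exists>N. \<forall>n\<ge>N. Z \<le> n + 1"
      by (rule exI[of _ "Z - 1"]) auto
  qed
  then have r': "((\<lambda>i. x (i + 1)) \<longlongrightarrow> r) at_top"
    using filterlim_compose[OF r] by blast
  have "l \<in> {u0, u1}" "r \<in> {u0, u1}"
    using orbit_limit_end[OF o l l'] orbit_limit_end[OF o r r'] by auto
  then have "l = a \<and> r = b \<or> l = b \<and> r = a"
    using lr ab less by (auto simp: doubleton_eq_iff)
  moreover have "\<not> (l = b \<and> r = a)"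
  proof
    assume "l = b \<and> r = a"
    define R where "R = pot a b + pot b a"
    have R: "0 < R" using round_trip_pos ab less by (auto simp: R_def doubleton_eq_iff add.commute)
    define d where "d = R / (4 * L)"
    have d: "0 < d" using R Lpos by (simp add: d_def)
    obtain m0 where m0: "\<And>i. i \<le> m0 \<Longrightarrow> \<bar>x i - b\<bar> < d"
      using tendstoD[OF l d] \<open>l = b \<and> r = a\<close> by (auto simp: eventually_at_bot_linorder dist_real_def)
    obtain n0 where n0: "\<And>i. n0 \<le> i \<Longrightarrow> \<bar>x i - a\<bar> < d"
      using tendstoD[OF r d] \<open>l = b \<and> r = a\<close> by (auto simp: eventually_at_top_linorder dist_real_def)
    define m n where "m = min m0 0" and "n = max n0 1"
    have mn: "m < n" "\<bar>x m - b\<bar> < d" "\<bar>x n - a\<bar> < d" using m0[of m] n0[of n] by (auto simp: m_def n_def)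
    note ai = ab_in(1)[OF ab] and bi = ab_in(2)[OF ab]
    have "pot a (x m) + pot (x m) (x n) \<le> pot a (x n)"
      using link_exc[OF ab, of m n x] o mn pot_le[OF mn(1) orbit_strip[OF o]] by (simp add: orbit_def)
    moreover have "pot a (x n) \<le> L * \<bar>x n - a\<bar>"
      using pot_lip2[OF ai xi ai, of n] a_end[OF ab] by simp
    moreover have "pot a b \<le> pot a (x m) + L * \<bar>x m - b\<bar>"
      using pot_lip2[OF ai bi xi, of m] by (simp add: abs_minus_commute)
    moreover have "pot b a \<le> pot (x m) (x n) + L * \<bar>x m - b\<bar> + L * \<bar>x n - a\<bar>"
      using pot_lip1[OF bi xi ai, of m] pot_lip2[OF xi ai xi, of m n] by (simp add: abs_minus_commute)
    moreover have "L * \<bar>x m - b\<bar> < L * d" "L * \<bar>x n - a\<bar> < L * d"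
      using mn Lpos by auto
    ultimately have "R < 4 * (L * d)" by (simp add: R_def)
    then show False using Lpos by (simp add: d_def)
  qed
  ultimately show "(x \<longlongrightarrow> a) at_bot" "(x \<longlongrightarrow> b) at_top" using l r by auto
qed

lemma orbit_minimal:
  assumes "orbit x"
  shows "minimal h x"
proof -
  have "energy h x n0 n1 \<le> energy h y n0 n1" if "n0 < n1" "y n0 = x n0" "y n1 = x n1" for y n0 n1
    using link_minimal[OF ab, of n0 n1 x y] assms that by (simp add: energy_exc orbit_def)
  then show ?thesis unfolding minimal_def minimal_between_def by blast
qed

text \<open>The contrapositive is how gaps among the connecting minimal configurations enter the argument: a point
  missed by them has a strictly positive detour cost.\<close>

lemma crit_connecting:
  assumes "z \<in> crit a b" "u0 < z" "z < u1"
  shows "z \<in> connecting h a b"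
proof -
  obtain x where x: "orbit x" "x 0 = z" using orbit_exists[OF assms(1)] .
  have "(x \<longlongrightarrow> a) at_bot" "(x \<longlongrightarrow> b) at_top"
    using orbit_limits[OF x(1)] x(2) assms(2,3) by auto
  then show ?thesis
    unfolding connecting_def mem_Collect_eq
    using x(2) orbit_minimal[OF x(1)] strip_rotation_number[OF orbit_strip[OF x(1)]]
    by (intro exI[of _ x] conjI) simp_all
qed

lemma closed_crit: "closed (crit a b)"
  unfolding crit_def
  by (rule continuous_closed_preimage_constant[OF continuous_on_add[OF continuous_pot2 continuous_pot1]])
    (use ab_in[OF ab] in simp_all)

lemma orbit_tends_source:
  assumes z: "z \<in> crit a b"
  shows "\<exists>x. orbit x \<and> x 0 = z \<and> (z \<noteq> b \<longrightarrow> (x \<longlongrightarrow> a) at_bot)"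
proof (cases "z = a")
  case True
  have "orbit (\<lambda>_. a)"
    using ends_crit[OF ab] a_end[OF ab] ends_c[of a] by (simp add: orbit_def link_def)
  then show ?thesis using True by (intro exI[of _ "\<lambda>_. a"]) simp
next
  case False
  obtain x where x: "orbit x" "x 0 = z" using orbit_exists[OF z] .
  have "(x \<longlongrightarrow> a) at_bot" if "z \<noteq> b"
  proof (rule orbit_limits[OF x(1)])
    have "z \<noteq> u0" "z \<noteq> u1" using that False ab by (auto simp: doubleton_eq_iff)
    then show "u0 < x 0" "x 0 < u1" using crit_in[OF z] x(2) by auto
  qed
  then show ?thesis using x by blast
qed

text \<open>The passage to predecessors preserves order and is a bijection of the critical set, so it maps gaps of
  this set to gaps. Its iterates move every critical point other than \<open>b\<close> towards \<open>a\<close>. At most one end of the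
  gap around \<open>v\<close> is \<open>b\<close>, so the gap reaches into any neighbourhood of \<open>a\<close> after finitely many steps.\<close>

lemma gap_near_source:
  assumes v: "u0 < v" "v < u1" "v \<notin> crit a b" and d: "0 < d"
  obtains w where "u0 < w" "w < u1" "w \<notin> crit a b" "\<bar>w - a\<bar> < d"
proof -
  have ends: "u0 \<in> crit a b" "u1 \<in> crit a b" using ends_crit[OF ab] ab by (auto simp: doubleton_eq_iff)
  define p where "p = Sup (crit a b \<inter> {..v})"
  define q where "q = Inf (crit a b \<inter> {v..})"
  have p: "p \<in> crit a b \<inter> {..v}"
    unfolding p_def by (rule closed_contains_Sup) (use ends v closed_crit in \<open>auto intro!: closed_Int\<close>)
  have q: "q \<in> crit a b \<inter> {v..}"
    unfolding q_def by (rule closed_contains_Inf) (use ends v closed_crit in \<open>auto intro!: closed_Int\<close>)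
  have pq: "p < q" using p q v by (metis IntE atLeast_iff atMost_iff le_less_trans less_le)
  have gap: "z \<notin> crit a b" if "p < z" "z < q" for z
  proof
    assume z: "z \<in> crit a b"
    show False
    proof (cases "z \<le> v")
      case True
      then have "z \<le> p" unfolding p_def using z by (intro cSup_upper) (auto intro: bdd_aboveI)
      then show False using that by simp
    next
      case False
      then have "q \<le> z" unfolding q_def using z by (intro cInf_lower) (auto intro: bdd_belowI)
      then show False using that by simp
    qed
  qed
  obtain x where x: "orbit x" "x 0 = p" "p \<noteq> b \<Longrightarrow> (x \<longlongrightarrow> a) at_bot"
    using orbit_tends_source[of p] p by blast
  obtain y where y: "orbit y" "y 0 = q" "q \<noteq> b \<Longrightarrow> (y \<longlongrightarrow> a) at_bot"
    using orbit_tends_source[of q] q by blast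
  have lt: "x i < y i" for i using orbit_less[OF x(1) y(1)] x y pq by simp
  have gaps: "z \<notin> crit a b" if "x (- int n) < z" "z < y (- int n)" for z n
    using that
  proof (induction n arbitrary: z)
    case 0 then show ?case using gap x y by simp
  next
    case (Suc n)
    show ?case
    proof
      assume z: "z \<in> crit a b"
      obtain w where w: "link a b z w" using link_succ[OF ab z] by blast
      have lx: "link a b (x (- int (Suc n))) (x (- int n))" "link a b (y (- int (Suc n))) (y (- int n))"
        using x(1) y(1) by (auto simp: orbit_def dest: spec[of _ "- int (Suc n)"])
      have "x (- int n) < w" "w < y (- int n)"
        using link_mono_succ[OF lx(1) w] link_mono_succ[OF w lx(2)] Suc.prems by auto
      then show False using Suc.IH w by (auto simp: link_def)
    qed
  qed
  have "\<exists>n. \<bar>x (- int n) - a\<bar> < d \<or> \<bar>y (- int n) - a\<bar> < d"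
  proof -
    have "p \<noteq> b \<or> q \<noteq> b" using pq by auto
    then have "(x \<longlongrightarrow> a) at_bot \<or> (y \<longlongrightarrow> a) at_bot" using x(3) y(3) by blast
    then obtain N where N: "(\<forall>i\<le>N. \<bar>x i - a\<bar> < d) \<or> (\<forall>i\<le>N. \<bar>y i - a\<bar> < d)"
      using tendstoD[OF _ d] by (fastforce simp: eventually_at_bot_linorder dist_real_def)
    have "- int (nat (- N)) \<le> N" by simp
    then show ?thesis using N by blast
  qed
  then obtain n where n: "\<bar>x (- int n) - a\<bar> < d \<or> \<bar>y (- int n) - a\<bar> < d" by blast
  define X Y where "X = x (- int n)" and "Y = y (- int n)"
  have XY: "X < Y" "u0 \<le> X" "Y \<le> u1"
    using lt orbit_strip[OF x(1)] orbit_strip[OF y(1)] by (auto simp: X_def Y_def strip_def)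
  have "\<exists>w. X < w \<and> w < Y \<and> \<bar>w - a\<bar> < d"
  proof (cases "\<bar>X - a\<bar> < d")
    case True
    then have "X < min Y (a + d)" using XY by auto
    then obtain w where "X < w" "w < min Y (a+d)" using dense by blast
    then show ?thesis using True by (intro exI[of _ w]) auto
  next
    case False
    then have "\<bar>Y - a\<bar> < d" using n by (simp add: X_def Y_def)
    then have "max X (a - d) < Y" using XY by auto
    then obtain w where "max X (a - d) < w" "w < Y" using dense by blast
    then show ?thesis using \<open>\<bar>Y - a\<bar> < d\<close> by (intro exI[of _ w]) auto
  qed
  then show thesis using that gaps XY by (force simp: X_def Y_def)
qed

end

text \<open>Time reversal of the previous result.\<close>

lemma gap_near_target:
  assumes ab: "{a, b} = {u0, u1}"
    and v: "u0 < v" "v < u1" "v \<notin> crit a b" and d: "0 < d"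
  obtains w where "u0 < w" "w < u1" "w \<notin> crit a b" "\<bar>w - b\<bar> < d"
proof -
  interpret T: twist_strip "\<lambda>x y. h y x" u0 u1 L c by (rule transposed)
  have "{b, a} = {u0, u1}" using ab by auto
  from T.gap_near_source[OF this v(1,2) _ d] show thesis
    using that v transposed_crit[OF ab] by metis
qed

lemma crit_iff: 
  assumes "{a, b} = {u0, u1}" "z \<in> {u0..u1}"
  shows "z \<notin> crit a b \<longleftrightarrow> pot a b < pot a z + pot z b"
  using pot_triangle[OF ab_in(1)[OF assms(1)] assms(2) ab_in(2)[OF assms(1)]] assms(2)
  by (auto simp: crit_def)

end

section \<open>Minimizers avoid noncritical boundary values\<close>

lemma index_seqs_less:
  assumes "k \<in> index_seqs" "i < j"
  shows "k i < k j"
  using assms(2)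
proof (induction j rule: int_gr_induct)
  case base then show ?case using assms(1) by (simp add: index_seqs_def)
next
  case (step j)
  moreover have "k j < k (j + 1)" using assms(1) by (simp add: index_seqs_def)
  ultimately show ?case by simp
qed

lemma index_seqs_less_iff: "k \<in> index_seqs \<Longrightarrow> k i < k j \<longleftrightarrow> i < j"
  using index_seqs_less[of k i j] index_seqs_less[of k j i] by (cases i j rule: linorder_cases) auto

lemma index_seqs_le_iff: "k \<in> index_seqs \<Longrightarrow> k i \<le> k j \<longleftrightarrow> i \<le> j"
  using index_seqs_less_iff[of k j i] by linarith

text \<open>The two sums make one formula for the partial sums in both directions; one of them is always empty.\<close>

lemma index_seqs_exists:
  fixes len :: "int \<Rightarrow> int"
  assumes "\<And>i. 0 < len i"
  obtains k where "k \<in> index_seqs" "\<And>i. k (i + 1) - k i = len i"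
proof -
  define k where "k i = (\<Sum>j\<in>{0..<i}. len j) - (\<Sum>j\<in>{i..<0}. len j)" for i
  have step: "k (i + 1) - k i = len i" for i
  proof (cases "0 \<le> i")
    case True
    then have "{0..<i+1} = insert i {0..<i}" by auto
    then show ?thesis using True by (simp add: k_def)
  next
    case False
    then have "{i..<0} = insert i {i+1..<0}" by auto
    then show ?thesis using False by (simp add: k_def)
  qed
  have "k i < k (i + 1)" for i using step[of i] assms[of i] by linarith
  then have "k \<in> index_seqs" by (simp add: index_seqs_def k_def)
  then show thesis using that step by blast
qed

context twist_strip
begin

text \<open>The ground state near which the constraint with index \<open>i\<close> keeps the configuration. Even indices
  start rest intervals and odd indices start transitions.\<close>

definition base :: "int \<Rightarrow> real" where
  "base i = (if i mod 4 = 0 \<or> i mod 4 = 1 then u0 else u1)"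

lemma base_end: "base i \<in> {u0, u1}"
  by (simp add: base_def)

lemma mod4_even:
  fixes i :: int
  assumes "even i"
  shows "i mod 4 = 0 \<and> (i + 1) mod 4 = 1 \<or> i mod 4 = 2 \<and> (i + 1) mod 4 = 3"
  using assms by presburger

lemma mod4_odd:
  fixes i :: int
  assumes "odd i"
  shows "i mod 4 = 1 \<and> (i + 1) mod 4 = 2 \<or> i mod 4 = 3 \<and> (i + 1) mod 4 = 0"
  using assms by presburger

lemma base_even: "even i \<Longrightarrow> base (i + 1) = base i"
  using mod4_even[of i] by (auto simp: base_def)

lemma base_odd: "odd i \<Longrightarrow> {base i, base (i + 1)} = {u0, u1}"
  using mod4_odd[of i] by (auto simp: base_def)

lemma constrained_iff:
  "x \<in> constrained u0 u1 k \<rho> \<longleftrightarrow> x \<in> strip u0 u1 \<and> (\<forall>i. \<bar>x (k i) - base i\<bar> \<le> \<rho> i)"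
proof
  assume x: "x \<in> constrained u0 u1 k \<rho>"
  have "x \<in> near u0 u1 u0 (k 0) (\<rho> 0)"
    using x unfolding constrained_def by (auto dest: bspec[of _ _ 0])
  moreover have "\<bar>x (k i) - base i\<bar> \<le> \<rho> i" for i
  proof -
    have "i mod 4 = 0 \<or> i mod 4 = 1 \<or> i mod 4 = 2 \<or> i mod 4 = 3" by presburger
    then show ?thesis using x by (auto simp: constrained_def near_def base_def)
  qed
  ultimately show "x \<in> strip u0 u1 \<and> (\<forall>i. \<bar>x (k i) - base i\<bar> \<le> \<rho> i)"
    by (simp add: near_def)
next
  assume x: "x \<in> strip u0 u1 \<and> (\<forall>i. \<bar>x (k i) - base i\<bar> \<le> \<rho> i)"
  have 1: "\<bar>x (k i) - u0\<bar> \<le> \<rho> i" if "i mod 4 = 0 \<or> i mod 4 = 1" for i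
    using x that by (auto simp: base_def dest: spec[of _ i])
  have 2: "\<bar>x (k i) - u1\<bar> \<le> \<rho> i" if "i mod 4 = 3 \<or> i mod 4 = 2" for i
    using x that by (auto simp: base_def dest: spec[of _ i])
  show "x \<in> constrained u0 u1 k \<rho>"
    unfolding constrained_def near_def using x by (intro IntI INT_I CollectI conjI) (auto intro: 1 2)
qed

lemma constrainedD: "x \<in> constrained u0 u1 k \<rho> \<Longrightarrow> \<bar>x (k i) - base i\<bar> \<le> \<rho> i"
  by (simp add: constrained_iff)

definition locally_minimal :: "(int \<Rightarrow> int) \<Rightarrow> (int \<Rightarrow> real) \<Rightarrow> config \<Rightarrow> bool" where
  "locally_minimal k \<rho> x \<longleftrightarrow> x \<in> constrained u0 u1 k \<rho> \<and>
     (\<forall>y l m. y \<in> constrained u0 u1 k \<rho> \<longrightarrow> l \<le> m \<longrightarrow> (\<forall>i. i \<le> l \<or> m \<le> i \<longrightarrow> y i = x i) \<longrightarrow>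
        exc x l m \<le> exc y l m)"

lemma locally_minimalD:
  "locally_minimal k \<rho> x \<Longrightarrow> y \<in> constrained u0 u1 k \<rho> \<Longrightarrow> l \<le> m \<Longrightarrow>
     (\<And>i. i \<le> l \<or> m \<le> i \<Longrightarrow> y i = x i) \<Longrightarrow> exc x l m \<le> exc y l m"
  by (simp add: locally_minimal_def)

text \<open>Resting at the ground state in the interior of the interval is an admissible competitor, so the excess
  energy there is at most of order \<open>\<eta>\<close>. If the interval is long, some interior point has small diagonal
  energy and is close to a ground state. It cannot be the wrong one, since the
  interval would then contain a round trip.\<close>

lemma rest_interval_near_base:
  assumes k: "k \<in> index_seqs" and x: "locally_minimal k \<rho> x" and i: "even i"
    and \<rho>: "\<rho> i \<le> \<eta>" "\<rho> (i + 1) \<le> \<eta>"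
    and \<eta>: "4 * L * \<eta> + 2 * L * d < pot u0 u1 + pot u1 u0"
    and \<mu>: "\<And>v. v \<in> {u0..u1} \<Longrightarrow> h v v - c < \<mu> \<Longrightarrow> \<bar>v - u0\<bar> < d \<or> \<bar>v - u1\<bar> < d"
    and N: "4 * L * \<eta> < of_int (k (i + 1) - k i - 1) * \<mu>"
  obtains l where "k i < l" "l < k (i + 1)" "\<bar>x l - base i\<bar> < d"
proof -
  define a m n where "a = base i" and "m = k i" and "n = k (i + 1)"
  have a: "a \<in> {u0, u1}" "base (i + 1) = a" using base_end base_even[OF i] by (auto simp: a_def)
  have mn: "m < n" using k by (simp add: m_def n_def index_seqs_def)
  have xc: "x \<in> constrained u0 u1 k \<rho>" using x by (simp add: locally_minimal_def)
  then have xs: "x \<in> strip u0 u1" by (simp add: constrained_iff)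
  have xm: "\<bar>x m - a\<bar> \<le> \<eta>" using constrainedD[OF xc, of i] \<rho>(1) unfolding m_def a_def by linarith
  have xn: "\<bar>x n - a\<bar> \<le> \<eta>" using constrainedD[OF xc, of "i + 1"] \<rho>(2) a(2) unfolding n_def by linarith
  have Lx: "L * \<bar>x m - a\<bar> \<le> L * \<eta>" "L * \<bar>x n - a\<bar> \<le> L * \<eta>" using xm xn Lpos by auto
  define y where "y j = (if m < j \<and> j < n then a else x j)" for j
  have yk: "y (k j) = x (k j)" for j
    unfolding y_def m_def n_def using index_seqs_less_iff[OF k] by auto
  have "y \<in> strip u0 u1" using xs ends_in[OF a(1)] by (auto simp: y_def strip_def)
  then have yc: "y \<in> constrained u0 u1 k \<rho>" using xc yk by (simp add: constrained_iff)
  have yx: "y j = x j" if "j \<le> m \<or> n \<le> j" for j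
    using that by (auto simp: y_def)
  have "exc x m n \<le> exc y m n"
    by (rule locally_minimalD[OF x yc _ yx]) (use mn in auto)
  also have "\<dots> \<le> L * \<bar>y m - a\<bar> + L * \<bar>y n - a\<bar>"
    by (rule exc_rest_le[OF ends_c[OF a(1)] mn]) (simp add: y_def)
  also have "\<dots> \<le> 2 * L * \<eta>" using Lx by (simp add: y_def)
  finally have ub: "exc x m n \<le> 2 * L * \<eta>" .
  have "L * \<bar>x n - x m\<bar> \<le> L * (\<bar>x m - a\<bar> + \<bar>x n - a\<bar>)" using Lpos by (intro mult_left_mono) auto
  then have "L * \<bar>x n - x m\<bar> \<le> 2 * L * \<eta>" using Lx by (simp add: distrib_left)
  then have s: "(\<Sum>j\<in>{m..<n}. h (x j) (x j) - c) \<le> 4 * L * \<eta>"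
    using exc_ge[of m n x] mn ub by simp
  have "\<exists>l. m < l \<and> l < n \<and> h (x l) (x l) - c < \<mu>"
  proof (rule ccontr)
    assume neg: "\<not> ?thesis"
    have "of_int (n - m - 1) * \<mu> = (\<Sum>j\<in>{m+1..<n}. \<mu>)" using mn by simp
    also have "\<dots> \<le> (\<Sum>j\<in>{m+1..<n}. h (x j) (x j) - c)"
      using neg by (intro sum_mono) auto
    also have "\<dots> \<le> (\<Sum>j\<in>{m..<n}. h (x j) (x j) - c)"
      using diag by (intro sum_mono2) auto
    finally show False using s N by (simp add: m_def n_def)
  qed
  then obtain l where l: "m < l" "l < n" "h (x l) (x l) - c < \<mu>" by blast
  have "\<bar>x l - u0\<bar> < d \<or> \<bar>x l - u1\<bar> < d" by (rule \<mu>[OF strip_in[OF xs] l(3)])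
  moreover have "\<not> \<bar>x l - b\<bar> < d" if ab: "{a, b} = {u0, u1}" for b
  proof
    assume xl: "\<bar>x l - b\<bar> < d"
    have R: "pot a b + pot b a = pot u0 u1 + pot u1 u0" using ab less by (auto simp: doubleton_eq_iff)
    have "pot a b \<le> pot (x m) (x l) + L * \<bar>x m - a\<bar> + L * \<bar>x l - b\<bar>"
      using pot_lip1[OF ab_in(1)[OF ab] strip_in[OF xs] ab_in(2)[OF ab], of m]
        pot_lip2[OF strip_in[OF xs] ab_in(2)[OF ab] strip_in[OF xs], of m l] by (simp add: abs_minus_commute)
    moreover have "pot b a \<le> pot (x l) (x n) + L * \<bar>x l - b\<bar> + L * \<bar>x n - a\<bar>"
      using pot_lip1[OF ab_in(2)[OF ab] strip_in[OF xs] ab_in(1)[OF ab], of l]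
        pot_lip2[OF strip_in[OF xs] ab_in(1)[OF ab] strip_in[OF xs], of l n] by (simp add: abs_minus_commute)
    moreover have "pot (x m) (x l) + pot (x l) (x n) \<le> exc x m n"
      using pot_le[OF l(1) xs] pot_le[OF l(2) xs] exc_split[of m l n x] l by simp
    moreover have "L * \<bar>x l - b\<bar> \<le> L * d" using xl Lpos by auto
    ultimately show False using Lx ub \<eta> R by simp
  qed
  ultimately have "\<bar>x l - a\<bar> < d"
    using a(1) by blast
  then show thesis using that l by (simp add: m_def n_def a_def)
qed

text \<open>If \<open>x\<close> passed through the noncritical point \<open>p\<close>, its excess energy between a point near \<open>a\<close> in the
  rest interval before and a point near \<open>b\<close> in the rest interval after the transition would exceed
  \<open>pot a b\<close> by nearly the detour cost of \<open>p\<close>. The competitor that rests at \<open>a\<close>, follows a near-optimal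
  transition exactly within the transition interval, and then rests at \<open>b\<close> satisfies all constraints and
  is cheaper.\<close>

lemma avoids_noncritical_value:
  assumes ab: "{a, b} = {u0, u1}" and p: "p \<in> {u0..u1}" "p \<notin> crit a b"
    and \<eta>: "0 < \<eta>" "6 * L * \<eta> < pot u0 u1 + pot u1 u0"
  obtains N :: nat where
    "\<And>k \<rho> x t i. k \<in> index_seqs \<Longrightarrow> locally_minimal k \<rho> x \<Longrightarrow> (\<And>j. 0 \<le> \<rho> j \<and> \<rho> j \<le> \<eta>) \<Longrightarrow> odd t \<Longrightarrow>
       base t = a \<Longrightarrow> base (t + 1) = b \<Longrightarrow> i = t \<or> i = t + 1 \<Longrightarrow>
       (\<And>j. t - 1 \<le> j \<Longrightarrow> j \<le> t + 1 \<Longrightarrow> int N \<le> k (j + 1) - k j) \<Longrightarrow> x (k i) \<noteq> p"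
proof -
  note ai = ab_in(1)[OF ab] and bi = ab_in(2)[OF ab] and ae = a_end[OF ab] and be = b_end[OF ab]
  define e where "e = pot a p + pot p b - pot a b"
  have e: "0 < e" using p crit_iff[OF ab p(1)] by (simp add: e_def)
  \<comment> \<open>Cutting at both ends costs \<open>2 * L * d\<close> in each of the two estimates below; their sum is at most
    half the detour cost \<open>e\<close>.\<close>
  define d where "d = min \<eta> (e / (8 * L))"
  have d: "0 < d" "d \<le> \<eta>" using \<eta> e Lpos by (auto simp: d_def)
  have "d \<le> e / (8 * L)" by (simp add: d_def)
  then have de: "8 * (L * d) \<le> e" using Lpos by (simp add: field_simps)
  obtain \<mu> where \<mu>: "0 < \<mu>" 
    "\<And>v. v \<in> {u0..u1} \<Longrightarrow> h v v - c < \<mu> \<Longrightarrow> \<bar>v - u0\<bar> < d \<or> \<bar>v - u1\<bar> < d"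
    using near_ends[OF d(1)] by blast
  obtain N1 where N1: "\<And>s n. N1 \<le> n \<Longrightarrow> \<exists>z\<in>strip u0 u1. z s = a \<and> z (s + n) = b \<and> exc z s (s + n) < pot a b + e/4"
    using long_transition[OF ae be, of "e/4"] e by auto
  obtain N2 :: nat where N2: "4 * L * \<eta> / \<mu> < N2" using reals_Archimedean2 by blast
  define N where "N = max (nat N1) (N2 + 1)"
  have Ld: "4 * L * \<eta> + 2 * L * d < pot u0 u1 + pot u1 u0"
  proof -
    have "L * d \<le> L * \<eta>" using d Lpos by simp
    then show ?thesis using \<eta>(2) by linarith
  qed
  have main: "x (k i) \<noteq> p"
    if k: "k \<in> index_seqs" and x: "locally_minimal k \<rho> x" and \<rho>: "\<And>j. 0 \<le> \<rho> j \<and> \<rho> j \<le> \<eta>"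
      and t: "odd t" and bt: "base t = a" "base (t + 1) = b" and i: "i = t \<or> i = t + 1"
      and long: "\<And>j. t - 1 \<le> j \<Longrightarrow> j \<le> t + 1 \<Longrightarrow> int N \<le> k (j + 1) - k j"
    for k \<rho> x t i
  proof
    assume xp: "x (k i) = p"
    have xc: "x \<in> constrained u0 u1 k \<rho>" using x by (simp add: locally_minimal_def)
    then have xs: "x \<in> strip u0 u1" by (simp add: constrained_iff)
    have count: "4 * L * \<eta> < of_int (k (j + 1) - k j - 1) * \<mu>" if "t - 1 \<le> j" "j \<le> t + 1" for j
    proof -
      have "4 * L * \<eta> < real N2 * \<mu>" using N2 \<mu>(1) by (simp add: field_simps)
      also have "int N2 \<le> k (j + 1) - k j - 1" using long[OF that] by (simp add: N_def)
      then have "real N2 * \<mu> \<le> of_int (k (j + 1) - k j - 1) * \<mu>"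
        using \<mu>(1) by (intro mult_right_mono) linarith+
      finally show ?thesis .
    qed
    obtain l where l: "k (t - 1) < l" "l < k t" "\<bar>x l - base (t - 1)\<bar> < d"
      using rest_interval_near_base[OF k x, of "t - 1" \<eta> d \<mu>] t \<rho> Ld \<mu>(2) count[of "t - 1"] by auto
    have bt1: "base (t - 1) = a" using base_even[of "t - 1"] t bt by simp
    obtain m where m: "k (t + 1) < m" "m < k (t + 1 + 1)" "\<bar>x m - base (t + 1)\<bar> < d"
      using rest_interval_near_base[OF k x, of "t + 1" \<eta> d \<mu>] t \<rho> Ld \<mu>(2) count[of "t + 1"] by auto
    have "N1 \<le> k (t + 1) - k t" using long[of t] by (simp add: N_def)
    from N1[OF this, of "k t"] obtain z where z: "z \<in> strip u0 u1" "z (k t) = a" "z (k (t + 1)) = b"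
      "exc z (k t) (k (t + 1)) < pot a b + e/4" by auto
    have kt: "k t < k (t + 1)" using k by (simp add: index_seqs_def)
    define y where "y j = (if j \<le> l \<or> m \<le> j then x j else if j < k t then a else if k (t + 1) < j then b else z j)" for j
    have ys: "y \<in> strip u0 u1" using xs z ai bi by (auto simp: y_def strip_def)
    have "\<bar>y (k j) - base j\<bar> \<le> \<rho> j" for j
    proof -
      consider "j \<le> t - 1" | "j = t" | "j = t + 1" | "t + 1 + 1 \<le> j" by linarith
      then show ?thesis
      proof cases
        case 1
        then have "k j \<le> l" using index_seqs_le_iff[OF k, of j "t - 1"] l by linarith
        then show ?thesis using xc by (simp add: y_def constrained_iff)
      next
        case 2
        then have "y (k j) = a" using l m kt z by (simp add: y_def)
        then show ?thesis using 2 bt \<rho> by simp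
      next
        case 3
        then have "y (k j) = b" using l m kt z by (simp add: y_def)
        then show ?thesis using 3 bt \<rho> by simp
      next
        case 4
        then have "m \<le> k j" using index_seqs_le_iff[OF k, of "t + 1 + 1" j] m by linarith
        then show ?thesis using xc by (simp add: y_def constrained_iff)
      qed
    qed
    then have yc: "y \<in> constrained u0 u1 k \<rho>" using ys by (simp add: constrained_iff)
    have yx: "y j = x j" if "j \<le> l \<or> m \<le> j" for j
      using that by (auto simp: y_def)
    have min: "exc x l m \<le> exc y l m"
      by (rule locally_minimalD[OF x yc _ yx]) (use l m kt in auto)
    have "exc y l m = exc y l (k t) + exc y (k t) (k (t + 1)) + exc y (k (t + 1)) m"
      using exc_split[of l "k t" m y] exc_split[of "k t" "k (t + 1)" m y] l m kt by simp
    moreover have "exc y l (k t) \<le> L * \<bar>y l - a\<bar> + L * \<bar>y (k t) - a\<bar>"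
      by (rule exc_rest_le[OF ends_c[OF ae] l(2)]) (use l m kt in \<open>auto simp: y_def\<close>)
    moreover have "exc y (k (t + 1)) m \<le> L * \<bar>y (k (t + 1)) - b\<bar> + L * \<bar>y m - b\<bar>"
      by (rule exc_rest_le[OF ends_c[OF be] m(1)]) (use l m kt in \<open>auto simp: y_def\<close>)
    moreover have "exc y (k t) (k (t + 1)) = exc z (k t) (k (t + 1))"
      by (rule exc_cong) (use l m kt in \<open>auto simp: y_def\<close>)
    moreover have "y l = x l" "y m = x m" "y (k t) = a" "y (k (t + 1)) = b"
      using l m kt z by (auto simp: y_def)
    moreover have Lx: "L * \<bar>x l - a\<bar> \<le> L * d" "L * \<bar>x m - b\<bar> \<le> L * d"
      using l(3) m(3) bt bt1 Lpos by auto
    ultimately have ub: "exc y l m \<le> pot a b + e/4 + 2 * (L * d)" using z(4) by simp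
    have ki: "l < k i" "k i < m" using i l m kt by auto
    have "pot (x l) p + pot p (x m) \<le> exc x l m"
      using pot_le[OF ki(1) xs] pot_le[OF ki(2) xs] exc_split[of l "k i" m x] ki xp by simp
    moreover have "pot a p \<le> pot (x l) p + L * d"
      using pot_lip1[OF ai strip_in[OF xs] p(1), of l] Lx by (simp add: abs_minus_commute)
    moreover have "pot p b \<le> pot p (x m) + L * d"
      using pot_lip2[OF p(1) bi strip_in[OF xs], of m] Lx by (simp add: abs_minus_commute)
    ultimately have "e \<le> e/4 + 4 * (L * d)" using min ub by (simp add: e_def)
    then show False using de e by simp
  qed
  show thesis by (rule that[of N]) (rule main)
qed

end

section \<open>Minimizers of the action\<close>

text \<open>A cluster point of minimizers of the functions \<open>F n\<close> works: by monotonicity in \<open>n\<close>, each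
  \<open>F m\<close> is eventually bounded along these minimizers by the values of \<open>F n\<close> at any competitor. The
  formulation with bounds \<open>M\<close> expresses that the limit minimizes the supremum, which may be infinite.\<close>

lemma exists_sup_minimizer:
  fixes F :: "nat \<Rightarrow> 'a::metric_space \<Rightarrow> real"
  assumes K: "compact K" "K \<noteq> {}" and cont: "\<And>n. continuous_on K (F n)"
    and inc: "\<And>x. x \<in> K \<Longrightarrow> incseq (\<lambda>n. F n x)"
  shows "\<exists>x\<in>K. \<forall>y\<in>K. \<forall>M. (\<forall>n. F n y \<le> M) \<longrightarrow> (\<forall>n. F n x \<le> M)"
proof -
  have "\<forall>n. \<exists>x. x \<in> K \<and> (\<forall>y\<in>K. F n x \<le> F n y)"
    using continuous_attains_inf[OF K cont] by blast
  from choice[OF this] obtain X where "\<forall>n. X n \<in> K \<and> (\<forall>y\<in>K. F n (X n) \<le> F n y)" ..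
  then have X: "X n \<in> K" "y \<in> K \<Longrightarrow> F n (X n) \<le> F n y" for n y by simp_all
  have "seq_compact K" using K(1) by (simp add: compact_eq_seq_compact_metric)
  moreover have "\<forall>n. X n \<in> K" using X(1) by simp
  ultimately obtain x r where x: "x \<in> K" "strict_mono r" "(X \<circ> r) \<longlonglongrightarrow> x"
    by (rule seq_compactE)
  have "F m x \<le> M" if y: "y \<in> K" "\<And>n. F n y \<le> M" for y M m
  proof (rule LIMSEQ_le_const2)
    show "(\<lambda>n. F m ((X \<circ> r) n)) \<longlonglongrightarrow> F m x"
      by (rule continuous_on_tendsto_compose[OF cont x(3,1)]) (use X(1) in simp)
    have "F m ((X \<circ> r) n) \<le> M" if "m \<le> n" for n
    proof -
      have "m \<le> r n" using that seq_suble[OF x(2), of n] by linarith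
      then have "F m (X (r n)) \<le> F (r n) (X (r n))" using inc[OF X(1)] by (simp add: incseq_def)
      also have "\<dots> \<le> F (r n) y" by (rule X(2)[OF y(1)])
      also have "\<dots> \<le> M" by (rule y(2))
      finally show ?thesis by simp
    qed
    then show "\<exists>N. \<forall>n\<ge>N. F m ((X \<circ> r) n) \<le> M" by blast
  qed
  then show ?thesis using x(1) by blast
qed

lemma compact_strip: "compact (strip u0 u1)"
proof -
  have "strip u0 u1 = PiE UNIV (\<lambda>_. {u0..u1})"
    by (auto simp: strip_def PiE_def Pi_def)
  moreover have "compactin (product_topology (\<lambda>_. euclidean) UNIV) (PiE UNIV (\<lambda>_::int. {u0..u1}))"
    unfolding compactin_PiE by simp
  ultimately show ?thesis by (simp add: euclidean_product_topology)
qed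

lemma sum_symmetric_Suc:
  fixes f :: "int \<Rightarrow> real"
  shows "(\<Sum>i\<in>{- int (Suc n)..int (Suc n)}. f i) = (\<Sum>i\<in>{- int n..int n}. f i) + f (int (Suc n)) + f (- int (Suc n))"
proof -
  have "{- int (Suc n)..int (Suc n)} = insert (int (Suc n)) (insert (- int (Suc n)) {- int n..int n})" by auto
  then show ?thesis by simp
qed

lemma index_seqs_ge:
  assumes "k \<in> index_seqs"
  shows "int n \<le> k (int n)" "k (- int n) \<le> - int n"
proof -
  have step: "k i < k (i + 1)" and k0: "k 0 = 0" for i using assms by (auto simp: index_seqs_def)
  show "int n \<le> k (int n)"
  proof (induction n)
    case (Suc n) then show ?case using step[of "int n"] by (simp add: add.commute)
  qed (simp add: k0)
  show "k (- int n) \<le> - int n"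
  proof (induction n)
    case (Suc n) then show ?case using step[of "- int (Suc n)"] by simp
  qed (simp add: k0)
qed

context twist_strip
begin

lemma continuous_h:
  assumes "continuous_on S f" "continuous_on S g"
  shows "continuous_on S (\<lambda>x. h (f x) (g x))"
  using assms unfolding continuous_on_def by (blast intro: tendsto_h)

lemma continuous_exc: "continuous_on S (\<lambda>x. exc x m n)"
proof -
  have "continuous_on S (\<lambda>x::config. x j)" for j
    by (rule continuous_on_subset[OF continuous_on_product_coordinates]) simp
  then show ?thesis
    unfolding exc_def by (intro continuous_on_sum continuous_on_diff continuous_h continuous_on_const)
qed

lemma compact_constrained: "compact (constrained u0 u1 k \<rho>)"
proof -
  have c: "continuous_on UNIV (\<lambda>x::config. x j)" for j
    by (rule continuous_on_product_coordinates)
  have "closed {x :: config. \<forall>i. \<bar>x (k i) - base i\<bar> \<le> \<rho> i}"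
    by (intro closed_Collect_all closed_Collect_le continuous_on_rabs continuous_on_diff continuous_on_const c)
  moreover have "constrained u0 u1 k \<rho> = strip u0 u1 \<inter> {x. \<forall>i. \<bar>x (k i) - base i\<bar> \<le> \<rho> i}"
    by (auto simp: constrained_iff)
  ultimately show ?thesis using compact_Int_closed[OF compact_strip] by simp
qed

lemma diag_min_eq: "diag_min h = c"
  unfolding diag_min_def using diag hu0 by (intro cInf_eq_minimum) auto

context
  fixes k \<rho>
  assumes k: "k \<in> index_seqs" and \<rho>: "\<rho> \<in> radius_seqs u0 u1"
begin

lemma rho_pos: "0 < \<rho> i"
  using \<rho> by (simp add: radius_seqs_def)

lemma k_step: "k i < k (i + 1)"
  using k by (simp add: index_seqs_def)

definition trans_set :: "int \<Rightarrow> config set" where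
  "trans_set i = near u0 u1 (base i) (k i) (\<rho> i) \<inter> near u0 u1 (base (i + 1)) (k (i + 1)) (\<rho> (i + 1))"

text \<open>The normalization of the renormalized energy in terms of excess energy.\<close>

definition offset :: "int \<Rightarrow> real" where
  "offset i = (if odd i then (INF x\<in>trans_set i. exc x (k i) (k (i + 1))) else 0)"

lemma trans_set_nonempty: "trans_set i \<noteq> {}"
proof -
  have "(\<lambda>j. if j = k i then base i else base (i + 1)) \<in> trans_set i"
    using ends_in[OF base_end] k_step[of i] rho_pos[of i] rho_pos[of "i + 1"]
    by (auto simp: trans_set_def near_def strip_def)
  then show ?thesis by blast
qed

lemma trans_bdd: "bdd_below ((\<lambda>x. exc x (k i) (k (i + 1))) ` trans_set i)"
proof (rule bdd_belowI2)
  fix x assume "x \<in> trans_set i"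
  then have x: "x \<in> strip u0 u1" by (simp add: trans_set_def near_def)
  have "L * \<bar>x (k (i + 1)) - x (k i)\<bar> \<le> L * (u1 - u0)"
    using strip_in[OF x, of "k i"] strip_in[OF x, of "k (i + 1)"] Lpos by (intro mult_left_mono) auto
  then show "- L * (u1 - u0) \<le> exc x (k i) (k (i + 1))"
    using exc_ge_dist[of "k i" "k (i + 1)" x] k_step[of i] by simp
qed

lemma renormalized_energy_eq:
  "renormalized_energy h u0 u1 k \<rho> i x = exc x (k i) (k (i + 1)) - offset i"
proof (cases "odd i")
  case False
  then have "i mod 4 \<noteq> 1" "i mod 4 \<noteq> 3" using mod4_even[of i] by auto
  then show ?thesis using False k_step[of i]
    by (simp add: renormalized_energy_def offset_def diag_min_eq energy_exc)
next
  case True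
  have "transition_min h u0 u1 k \<rho> (base i) (base (i + 1)) i = (INF x\<in>trans_set i. energy h x (k i) (k (i + 1)))"
    by (simp add: transition_min_def trans_set_def)
  also have "\<dots> = (INF x\<in>trans_set i. of_int (k (i + 1) - k i) * c + exc x (k i) (k (i + 1)))"
    using k_step[of i] by (intro INF_cong) (auto simp: energy_exc)
  also have "\<dots> = of_int (k (i + 1) - k i) * c + (INF x\<in>trans_set i. exc x (k i) (k (i + 1)))"
    by (rule Inf_add_eq[OF trans_bdd trans_set_nonempty])
  finally have t: "transition_min h u0 u1 k \<rho> (base i) (base (i + 1)) i = offset i + of_int (k (i + 1) - k i) * c"
    using True by (simp add: offset_def)
  from mod4_odd[OF True] show ?thesis
  proof
    assume m: "i mod 4 = 1 \<and> (i + 1) mod 4 = 2"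
    then have "base i = u0" "base (i + 1) = u1" by (auto simp: base_def)
    then show ?thesis using t m k_step[of i] by (simp add: renormalized_energy_def energy_exc)
  next
    assume m: "i mod 4 = 3 \<and> (i + 1) mod 4 = 0"
    then have "base i = u1" "base (i + 1) = u0" by (auto simp: base_def)
    then show ?thesis using t m k_step[of i] by (simp add: renormalized_energy_def energy_exc)
  qed
qed

text \<open>A rest interval can have negative excess energy, but not below \<open>- slack i\<close>. With this summable
  correction all terms become nonnegative on the constrained set, and the partial sums of the action
  increase.\<close>

definition slack :: "int \<Rightarrow> real" where
  "slack i = L * (\<rho> i + \<rho> (i + 1))"

definition part_action :: "nat \<Rightarrow> config \<Rightarrow> real" where
  "part_action n x = (\<Sum>i\<in>{- int n..int n}. exc x (k i) (k (i + 1)) - offset i + slack i)"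

lemma slack_nonneg: "0 \<le> slack i"
  using rho_pos[of i] rho_pos[of "i + 1"] Lpos by (simp add: slack_def)

lemma summable_rho: "\<rho> summable_on UNIV"
  using \<rho> by (simp add: radius_seqs_def)

lemma summable_slack: "slack summable_on UNIV"
proof -
  have "(\<lambda>i. \<rho> (i + 1)) summable_on UNIV \<longleftrightarrow> \<rho> summable_on UNIV"
    by (rule summable_on_reindex_bij_betw) (rule bij_betwI[of _ _ _ "\<lambda>i. i - 1"], auto)
  then show ?thesis
    unfolding slack_def using summable_rho by (intro summable_on_cmult_right summable_on_add) auto
qed

lemma sum_le_infsum:
  fixes f :: "int \<Rightarrow> real"
  assumes "f summable_on UNIV" "\<And>i. 0 \<le> f i" "finite A"
  shows "sum f A \<le> infsum f UNIV"
  by (rule finite_sum_le_infsum) (use assms in auto)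

lemma trans_le:
  assumes "odd i" "x \<in> constrained u0 u1 k \<rho>"
  shows "offset i \<le> exc x (k i) (k (i + 1))"
proof -
  have "x \<in> trans_set i" using assms(2) by (auto simp: trans_set_def near_def constrained_iff)
  then show ?thesis using assms(1) by (auto simp: offset_def intro: cINF_lower[OF trans_bdd])
qed

lemma summand_nonneg:
  assumes x: "x \<in> constrained u0 u1 k \<rho>"
  shows "0 \<le> exc x (k i) (k (i + 1)) - offset i + slack i"
proof (cases "odd i")
  case True
  then show ?thesis using trans_le[OF True x] slack_nonneg[of i] by simp
next
  case False
  then have "\<bar>x (k i) - base i\<bar> \<le> \<rho> i" "\<bar>x (k (i + 1)) - base i\<bar> \<le> \<rho> (i + 1)"
    using constrainedD[OF x, of i] constrainedD[OF x, of "i + 1"] base_even[of i] by auto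
  then have "L * \<bar>x (k (i + 1)) - x (k i)\<bar> \<le> slack i"
    unfolding slack_def using Lpos by (intro mult_left_mono) auto
  then show ?thesis using exc_ge_dist[of "k i" "k (i + 1)" x] k_step[of i] False
    by (simp add: offset_def)
qed

lemma part_action_mono:
  assumes "x \<in> constrained u0 u1 k \<rho>"
  shows "incseq (\<lambda>n. part_action n x)"
  unfolding part_action_def
  by (rule incseq_SucI) (use summand_nonneg[OF assms] in \<open>intro sum_mono2, auto\<close>)

lemma continuous_part_action: "continuous_on S (part_action n)"
  unfolding part_action_def by (intro continuous_intros continuous_exc)

text \<open>Follow almost optimal transitions on the odd intervals and rest at the ground state in between. Each
  term then exceeds its minimum by an amount of order \<open>\<rho>\<close>, which is summable.\<close>

lemma exists_finite_part_action:
  obtains y C where "y \<in> constrained u0 u1 k \<rho>" "\<And>n. part_action n y \<le> C"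
proof -
  have "\<exists>w\<in>trans_set i. exc w (k i) (k (i + 1)) < offset i + \<rho> i" if "odd i" for i
  proof -
    have "(INF x\<in>trans_set i. exc x (k i) (k (i + 1))) < offset i + \<rho> i"
      using that rho_pos[of i] by (simp add: offset_def)
    then show ?thesis using cINF_less_iff[OF trans_set_nonempty trans_bdd] by blast
  qed
  then obtain w where w: "\<And>i. odd i \<Longrightarrow> w i \<in> trans_set i"
    "\<And>i. odd i \<Longrightarrow> exc (w i) (k i) (k (i + 1)) < offset i + \<rho> i" by metis
  \<comment> \<open>The index in question is unique: the closed intervals with odd index are pairwise disjoint, and so
    are the open ones with even index that lie between them.\<close>
  define y where "y j = (if \<exists>i. odd i \<and> k i \<le> j \<and> j \<le> k (i + 1)
      then w (THE i. odd i \<and> k i \<le> j \<and> j \<le> k (i + 1)) j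
      else base (THE i. even i \<and> k i < j \<and> j < k (i + 1)))" for j
  have the_odd: "(THE i. odd i \<and> k i \<le> j \<and> j \<le> k (i + 1)) = i"
    if i: "odd i" "k i \<le> j" "j \<le> k (i + 1)" for i j
  proof (rule the_equality)
    fix i' assume i': "odd i' \<and> k i' \<le> j \<and> j \<le> k (i' + 1)"
    then have "k i' \<le> k (i + 1)" "k i \<le> k (i' + 1)" using i by auto
    then have "i' \<le> i + 1" "i \<le> i' + 1" using index_seqs_le_iff[OF k] by auto
    then have "i' = i - 1 \<or> i' = i \<or> i' = i + 1" by auto
    then show "i' = i" using i' i by auto
  qed (use i in simp)
  have y_odd: "y j = w i j" if i: "odd i" "k i \<le> j" "j \<le> k (i + 1)" for i j
  proof -
    have "\<exists>i. odd i \<and> k i \<le> j \<and> j \<le> k (i + 1)" using i by blast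
    then show ?thesis using the_odd[OF i] by (simp add: y_def)
  qed
  have y_even: "y j = base i" if i: "even i" "k i < j" "j < k (i + 1)" for i j
  proof -
    have ne: "\<not> (\<exists>i. odd i \<and> k i \<le> j \<and> j \<le> k (i + 1))"
    proof
      assume "\<exists>i. odd i \<and> k i \<le> j \<and> j \<le> k (i + 1)"
      then obtain i' where i': "odd i'" "k i' \<le> j" "j \<le> k (i' + 1)" by blast
      then have "k i' < k (i + 1)" "k i < k (i' + 1)" using i by auto
      then have "i' < i + 1" "i < i' + 1" using index_seqs_less_iff[OF k] by auto
      then show False using i i' by simp
    qed
    have "(THE i. even i \<and> k i < j \<and> j < k (i + 1)) = i"
    proof (rule the_equality)
      fix i' assume i': "even i' \<and> k i' < j \<and> j < k (i' + 1)"
      then have "k i' < k (i + 1)" "k i < k (i' + 1)" using i by auto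
      then have "i' < i + 1" "i < i' + 1" using index_seqs_less_iff[OF k] by auto
      then show "i' = i" by simp
    qed (use i in simp)
    then show ?thesis unfolding y_def if_not_P[OF ne] by simp
  qed
  have wt: "w i \<in> strip u0 u1 \<and> \<bar>w i (k i) - base i\<bar> \<le> \<rho> i \<and> \<bar>w i (k (i + 1)) - base (i + 1)\<bar> \<le> \<rho> (i + 1)"
    if "odd i" for i
    using w(1)[OF that] by (auto simp: trans_set_def near_def)
  have "y j \<in> {u0..u1}" for j
  proof (cases "\<exists>i. odd i \<and> k i \<le> j \<and> j \<le> k (i + 1)")
    case True
    then show ?thesis using y_odd wt strip_in by metis
  next
    case False
    show ?thesis unfolding y_def if_not_P[OF False] by (rule ends_in[OF base_end])
  qed
  moreover have "\<bar>y (k i) - base i\<bar> \<le> \<rho> i" for i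
  proof (cases "odd i")
    case True
    then show ?thesis using y_odd[of i "k i"] wt[of i] k_step[of i] by simp
  next
    case False
    then show ?thesis using y_odd[of "i - 1" "k i"] wt[of "i - 1"] k_step[of "i - 1"] by simp
  qed
  ultimately have yc: "y \<in> constrained u0 u1 k \<rho>"
    by (auto simp: constrained_iff strip_def)
  have summand_le: "exc y (k i) (k (i + 1)) - offset i + slack i \<le> \<rho> i + 2 * slack i" for i
  proof (cases "odd i")
    case True
    then have "exc y (k i) (k (i + 1)) = exc (w i) (k i) (k (i + 1))"
      by (intro exc_cong y_odd) auto
    then show ?thesis using w(2)[OF True] slack_nonneg[of i] by simp
  next
    case False
    then have "exc y (k i) (k (i + 1)) \<le> L * \<bar>y (k i) - base i\<bar> + L * \<bar>y (k (i + 1)) - base i\<bar>"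
      by (intro exc_rest_le ends_c base_end k_step y_even) auto
    also have "\<dots> = L * (\<bar>y (k i) - base i\<bar> + \<bar>y (k (i + 1)) - base (i + 1)\<bar>)"
      using False base_even[of i] by (simp add: distrib_left)
    also have "\<dots> \<le> slack i"
      unfolding slack_def using Lpos constrainedD[OF yc, of i] constrainedD[OF yc, of "i + 1"]
      by (intro mult_left_mono) auto
    finally show ?thesis using False rho_pos[of i] by (simp add: offset_def)
  qed
  have sm: "(\<lambda>i. \<rho> i + 2 * slack i) summable_on UNIV"
    by (intro summable_on_add summable_on_cmult_right summable_rho summable_slack)
  have nonneg: "0 \<le> \<rho> i + 2 * slack i" for i using rho_pos[of i] slack_nonneg[of i] by simp
  have "part_action n y \<le> infsum (\<lambda>i. \<rho> i + 2 * slack i) UNIV" for n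
  proof -
    have "part_action n y \<le> (\<Sum>i\<in>{- int n..int n}. \<rho> i + 2 * slack i)"
      unfolding part_action_def by (intro sum_mono summand_le)
    also have "\<dots> \<le> infsum (\<lambda>i. \<rho> i + 2 * slack i) UNIV"
      by (rule sum_le_infsum[OF sm nonneg]) simp
    finally show ?thesis .
  qed
  then show thesis using that yc by blast
qed

text \<open>The slack is subtracted again in the limit, where its partial sums converge.\<close>

lemma action_eq:
  assumes x: "x \<in> constrained u0 u1 k \<rho>"
  shows "action h u0 u1 k \<rho> x = (SUP n. ereal (part_action n x)) + ereal (- infsum slack UNIV)"
proof -
  define B where "B n = (\<Sum>i\<in>{- int n..int n}. slack i)" for n
  have "(slack has_sum infsum slack UNIV) UNIV" using summable_slack by (rule has_sum_infsum)
  then have f: "(sum slack \<longlongrightarrow> infsum slack UNIV) (finite_subsets_at_top UNIV)"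
    by (simp add: has_sum_def)
  have "filterlim (\<lambda>n. {- int n..int n}) (finite_subsets_at_top UNIV) sequentially"
    unfolding filterlim_finite_subsets_at_top
  proof (intro allI impI)
    fix X :: "int set" assume X: "finite X \<and> X \<subseteq> UNIV"
    define M where "M = Max (insert 0 (abs ` X))"
    have M: "\<bar>j\<bar> \<le> M" if "j \<in> X" for j
      unfolding M_def using X that by (intro Max_ge) auto
    have "X \<subseteq> {- int n..int n}" if "nat M \<le> n" for n
    proof
      fix j assume "j \<in> X"
      then have "\<bar>j\<bar> \<le> M" by (rule M)
      then show "j \<in> {- int n..int n}" using that by auto
    qed
    then show "\<forall>\<^sub>F n in sequentially. finite {- int n..int n} \<and> X \<subseteq> {- int n..int n} \<and> {- int n..int n} \<subseteq> UNIV"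
      unfolding eventually_sequentially by blast
  qed
  then have B: "B \<longlonglongrightarrow> infsum slack UNIV"
    unfolding B_def by (rule filterlim_compose[OF f])
  have s: "(\<Sum>i\<in>{- int n..int n}. renormalized_energy h u0 u1 k \<rho> i x) = part_action n x + (- B n)" for n
    by (simp add: renormalized_energy_eq part_action_def B_def sum.distrib)
  have 1: "(\<lambda>n. ereal (part_action n x)) \<longlonglongrightarrow> (SUP n. ereal (part_action n x))"
    by (rule LIMSEQ_SUP) (use part_action_mono[OF x] in \<open>simp add: incseq_def\<close>)
  have 2: "(\<lambda>n. ereal (- B n)) \<longlonglongrightarrow> ereal (- infsum slack UNIV)"
    by (intro tendsto_ereal tendsto_minus B)
  have "(\<lambda>n. ereal (part_action n x) + ereal (- B n)) \<longlonglongrightarrow>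
      (SUP n. ereal (part_action n x)) + ereal (- infsum slack UNIV)"
    by (rule tendsto_add_ereal_general[OF _ 1 2]) simp
  then show ?thesis unfolding action_def s plus_ereal.simps(1)[symmetric] by (rule limI)
qed

text \<open>The terms of the action are the excess energies of adjacent intervals, so they telescope up to constants.\<close>

lemma part_action_diff:
  assumes yx: "\<And>i. i \<le> l \<or> m \<le> i \<Longrightarrow> y i = x i" and lm: "l \<le> m" and n: "nat \<bar>l\<bar> \<le> n" "nat \<bar>m\<bar> \<le> n"
  shows "part_action n y = part_action n x + (exc y l m - exc x l m)"
proof -
  have tele: "part_action n x = exc x (k (- int n)) (k (int n + 1)) + (\<Sum>i\<in>{- int n..int n}. slack i - offset i)" for n x
  proof (induction n)
    case 0
    then show ?case by (simp add: part_action_def)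
  next
    case (Suc n)
    have le: "k (- int (Suc n)) \<le> k (- int n)" "k (- int n) \<le> k (int n + 1)" "k (int n + 1) \<le> k (int (Suc n) + 1)"
      using index_seqs_le_iff[OF k] by auto
    have "exc x (k (- int (Suc n))) (k (int (Suc n) + 1))
       = exc x (k (- int (Suc n))) (k (- int n)) + exc x (k (- int n)) (k (int n + 1)) + exc x (k (int n + 1)) (k (int (Suc n) + 1))"
      using exc_split[of "k (- int (Suc n))" "k (- int n)" "k (int (Suc n) + 1)" x]
        exc_split[of "k (- int n)" "k (int n + 1)" "k (int (Suc n) + 1)" x] le by simp
    then show ?case
      using Suc unfolding part_action_def sum_symmetric_Suc by (simp add: add.commute)
  qed
  define p q where "p = k (- int n)" and "q = k (int n + 1)"
  have "p \<le> - int n" using index_seqs_ge(2)[OF k] by (simp add: p_def)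
  then have pl: "p \<le> l" using n by linarith
  have "int n \<le> q" using index_seqs_ge(1)[OF k, of n] k_step[of "int n"] by (simp add: q_def)
  then have mq: "m \<le> q" using n by linarith
  have s: "exc z p q = exc z p l + exc z l m + exc z m q" for z
    using exc_split[of p l q z] exc_split[of l m q z] pl mq lm by simp
  have "exc y p l = exc x p l" "exc y m q = exc x m q"
    by (rule exc_cong, rule yx, simp)+
  then show ?thesis using s[of x] s[of y] unfolding tele by (simp add: p_def q_def)
qed

lemma exists_action_minimizer:
  obtains x where "is_arg_min (action h u0 u1 k \<rho>) (\<lambda>y. y \<in> constrained u0 u1 k \<rho>) x"
    "locally_minimal k \<rho> x"
proof -
  let ?K = "constrained u0 u1 k \<rho>"
  obtain y0 C where y0: "y0 \<in> ?K" "\<And>n. part_action n y0 \<le> C"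
    using exists_finite_part_action by blast
  have ne: "?K \<noteq> {}" using y0(1) by blast
  obtain x where x: "x \<in> ?K" "\<forall>y\<in>?K. \<forall>M. (\<forall>n. part_action n y \<le> M) \<longrightarrow> (\<forall>n. part_action n x \<le> M)"
    using exists_sup_minimizer[OF compact_constrained ne continuous_part_action part_action_mono] by blast
  have xmin: "part_action n x \<le> M" if "y \<in> ?K" "\<And>n. part_action n y \<le> M" for y M n
    using x(2) that by blast
  have inc: "part_action m z \<le> part_action n z" if "z \<in> ?K" "m \<le> n" for m n z
    using part_action_mono[OF that(1)] that(2) by (simp add: incseq_def)
  have xC: "part_action n x \<le> C" for n by (rule xmin[OF y0])
  have "\<not> action h u0 u1 k \<rho> y < action h u0 u1 k \<rho> x" if y: "y \<in> ?K" for y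
  proof
    let ?A = "\<lambda>z. SUP n. ereal (part_action n z)"
    assume less: "action h u0 u1 k \<rho> y < action h u0 u1 k \<rho> x"
    have "\<not> ?A x \<le> ?A y"
    proof
      assume "?A x \<le> ?A y"
      then have "action h u0 u1 k \<rho> x \<le> action h u0 u1 k \<rho> y"
        unfolding action_eq[OF y] action_eq[OF x(1)] by (rule add_right_mono)
      then show False using less by (simp add: leD)
    qed
    then have "?A y < ?A x" by simp
    then obtain n where n: "?A y < ereal (part_action n x)"
      unfolding less_SUP_iff by blast
    have low: "ereal (part_action 0 y) \<le> ?A y" by (rule SUP_upper) simp
    obtain r where r: "?A y = ereal r"
    proof (cases "?A y")
      case (real r) then show thesis by (rule that)
    next
      case PInf then show thesis using n by simp
    next
      case MInf then show thesis using low by simp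
    qed
    have "part_action m y \<le> r" for m
      using SUP_upper[of m UNIV "\<lambda>n. ereal (part_action n y)"] r by simp
    then have "part_action n x \<le> r" by (rule xmin[OF y])
    then show False using n r by simp
  qed
  then have 1: "is_arg_min (action h u0 u1 k \<rho>) (\<lambda>y. y \<in> ?K) x"
    using x(1) by (auto simp: is_arg_min_def)
  have local: "exc x l m \<le> exc y l m"
    if y: "y \<in> ?K" and lm: "l \<le> m" and yx: "\<And>i. i \<le> l \<or> m \<le> i \<Longrightarrow> y i = x i" for y l m
  proof -
    define D where "D = exc y l m - exc x l m"
    define n0 where "n0 = max (nat \<bar>l\<bar>) (nat \<bar>m\<bar>)"
    define V where "V = (SUP n. part_action n x)"
    have bdd: "bdd_above (range (\<lambda>n. part_action n x))" by (rule bdd_aboveI2) (rule xC)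
    have V: "part_action n x \<le> V" for n unfolding V_def by (rule cSUP_upper[OF _ bdd]) simp
    have "part_action n y \<le> V + D" for n
    proof -
      have "part_action n y \<le> part_action (max n n0) y" by (rule inc[OF y]) simp
      also have "\<dots> = part_action (max n n0) x + D"
        unfolding D_def by (rule part_action_diff[OF yx lm]) (simp_all add: n0_def le_max_iff_disj)
      finally show ?thesis using V[of "max n n0"] by simp
    qed
    then have "part_action n x \<le> V + D" for n by (rule xmin[OF y])
    then have "V \<le> V + D" unfolding V_def by (intro cSUP_least) auto
    then show ?thesis by (simp add: D_def)
  qed
  have "locally_minimal k \<rho> x"
    unfolding locally_minimal_def by (intro conjI allI impI x(1), rule local) auto
  then show thesis using that 1 by blast
qed

end
end

section \<open>Stationarity\<close>

text \<open>The difference quotients increase with \<open>t\<close>, so they have a limit from the left, and it lies below all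
  difference quotients to the right.\<close>

lemma convex_left_derivative:
  fixes f :: "real \<Rightarrow> real"
  assumes f: "convex_on UNIV f"
  obtains a where "(f has_real_derivative a) (at_left s)" "\<And>t. f s + a * (t - s) \<le> f t"
proof -
  define q where "q t = (f t - f s) / (t - s)" for t
  have mono: "q t \<le> q t'" if "t \<le> t'" "t' < s" for t t'
    using convex_on_slope_le(2)[OF f, of t s t'] that by (cases "t = t'") (auto simp: q_def)
  have upper: "q t \<le> q u" if "t < s" "s < u" for t u
    using convex_on_slope_le[OF f, of t u s] that unfolding q_def
    by (metis UNIV_I minus_diff_eq minus_divide_divide order_trans)
  define a where "a = Sup (q ` {..<s})"
  have bdd: "bdd_above (q ` {..<s})"
    using upper[of _ "s + 1"] by (intro bdd_aboveI2) auto
  have le: "q t \<le> a" if "t < s" for t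
    unfolding a_def by (rule cSUP_upper[OF _ bdd]) (use that in simp)
  have ge: "a \<le> q u" if "s < u" for u
    unfolding a_def by (rule cSUP_least) (use upper that lt_ex in auto)
  have "(q \<longlongrightarrow> a) (at_left s)"
  proof (rule order_tendstoI)
    fix y assume "y < a"
    then have "\<exists>t\<in>{..<s}. y < q t"
      unfolding a_def by (subst (asm) less_cSUP_iff[OF _ bdd]) (use lt_ex in auto)
    then obtain t0 where t0: "t0 < s" "y < q t0" by auto
    have "y < q t" if "t0 < t" "t < s" for t
      using mono[of t0 t] that t0 by simp
    then show "\<forall>\<^sub>F t in at_left s. y < q t"
      using t0(1) unfolding eventually_at_left[OF t0(1)] by blast
  next
    fix y assume y: "a < y"
    have "q t < y" if "t < s" for t using le[OF that] y by simp
    then show "\<forall>\<^sub>F t in at_left s. q t < y"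
      unfolding eventually_at_left[of "s - 1" s, simplified] by (intro exI[of _ "s - 1"]) auto
  qed
  then have "(f has_real_derivative a) (at_left s)"
    unfolding has_field_derivative_iff q_def .
  moreover have "f s + a * (t - s) \<le> f t" for t
  proof (cases t s rule: linorder_cases)
    case less
    then show ?thesis using le[OF less] by (simp add: q_def neg_divide_le_eq algebra_simps)
  next
    case greater
    then show ?thesis using ge[OF greater] by (simp add: q_def pos_le_divide_eq algebra_simps)
  qed simp
  ultimately show thesis by (rule that)
qed

lemma semiconcave_left_derivative:
  fixes f :: "real \<Rightarrow> real"
  assumes f: "convex_on UNIV (\<lambda>t. \<theta> * t\<^sup>2 / 2 - f t)"
  shows "\<exists>a. (f has_real_derivative a) (at_left s) \<and>
    (\<forall>t. f t \<le> f s + a * (t - s) + \<theta> * (t - s)\<^sup>2 / 2)"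
proof -
  let ?C = "\<lambda>t. \<theta> * t\<^sup>2 / 2 - f t"
  obtain b where b: "(?C has_real_derivative b) (at_left s)" "\<And>t. ?C s + b * (t - s) \<le> ?C t"
    using convex_left_derivative[OF f] by blast
  have "((\<lambda>t. \<theta> * t\<^sup>2 / 2 - ?C t) has_real_derivative (\<theta> * s - b)) (at_left s)"
    by (rule derivative_eq_intros b refl | simp)+
  then have "(f has_real_derivative (\<theta> * s - b)) (at_left s)" by simp
  moreover have "f t \<le> f s + (\<theta> * s - b) * (t - s) + \<theta> * (t - s)\<^sup>2 / 2" for t
    using b(2)[of t] by (simp add: power2_eq_square field_simps)
  ultimately show ?thesis by blast
qed

lemma critical_slope_zero:
  fixes g \<theta> r :: real
  assumes "0 < \<theta>" "0 < r" and le: "\<And>u. \<bar>u\<bar> < r \<Longrightarrow> 0 \<le> g * u + \<theta> * u\<^sup>2"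
  shows "g = 0"
proof (rule ccontr)
  assume g: "g \<noteq> 0"
  \<comment> \<open>A step of length \<open>m * \<bar>g\<bar>\<close> against the slope stays within \<open>r\<close> and is too short for the
    quadratic term to win.\<close>
  define m where "m = min (r / (2 * \<bar>g\<bar>)) (1 / (2 * \<theta>))"
  have m: "0 < m" using assms g by (simp add: m_def)
  have "m \<le> r / (2 * \<bar>g\<bar>)" by (simp add: m_def)
  then have "\<bar>g\<bar> * m \<le> r / 2" using g by (simp add: field_simps)
  then have "\<bar>- (g * m)\<bar> < r" using assms m by (simp add: abs_mult)
  then have "0 \<le> g * (- (g * m)) + \<theta> * (- (g * m))\<^sup>2" by (rule le)
  also have "\<dots> = g\<^sup>2 * m * (\<theta> * m - 1)" by (simp add: power2_eq_square algebra_simps)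
  finally have "0 \<le> g\<^sup>2 * m * (\<theta> * m - 1)" .
  moreover have "m \<le> 1 / (2 * \<theta>)" by (simp add: m_def)
  then have "\<theta> * m - 1 < 0" using assms(1) by (simp add: field_simps)
  moreover have "0 < g\<^sup>2 * m" using g m by simp
  ultimately show False by (simp add: zero_le_mult_iff)
qed

text \<open>Otherwise it would pay to go to \<open>v\<close>, stay there for a long time, and return.\<close>

lemma minimal_constant_diagonal:
  assumes "minimal h (\<lambda>_. u)"
  shows "h u u \<le> h v v"
proof (rule ccontr)
  assume "\<not> ?thesis"
  then have e: "0 < h u u - h v v" by simp
  obtain n :: nat where n: "h u v + h v u - 2 * h v v < n * (h u u - h v v)"
    using ex_less_of_nat_mult[OF e] by blast
  define N where "N = int n + 2"
  define y where "y i = (if i = 0 \<or> i = N then u else v)" for i :: int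
  have "minimal_between h 0 N (\<lambda>_. u)" using assms unfolding minimal_def by blast
  then have "energy h (\<lambda>_. u) 0 N \<le> energy h y 0 N"
    by (rule minimal_between_def[THEN iffD1, rule_format]) (simp_all add: y_def N_def)
  moreover have "energy h (\<lambda>_. u) 0 N = of_int N * h u u"
    by (simp add: energy_def N_def)
  moreover have "energy h y 0 N = h u v + h v u + n * h v v"
  proof -
    have I: "{0..<N} = insert 0 (insert (N - 1) {1..<N - 1})" by (auto simp: N_def)
    have "(\<Sum>i\<in>{1..<N - 1}. h (y i) (y (i + 1))) = (\<Sum>i\<in>{1..<N - 1}. h v v)"
      by (intro sum.cong) (auto simp: y_def)
    also have "\<dots> = n * h v v" by (simp add: N_def)
    finally show ?thesis unfolding energy_def I by (simp add: y_def N_def)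
  qed
  ultimately have "(real n + 2) * h u u \<le> h u v + h v u + real n * h v v" by (simp add: N_def)
  then show False using n e by (simp add: algebra_simps)
qed

lemma minimal_constantI:
  fixes h :: "real \<Rightarrow> real \<Rightarrow> real"
  assumes twist: "\<And>x x' y y'. x < x' \<Longrightarrow> y < y' \<Longrightarrow> h x y + h x' y' < h x y' + h x' y"
    and "\<And>v. h u u \<le> h v v"
  shows "minimal h (\<lambda>_. u)"
proof -
  have "energy h (\<lambda>_. u) m n \<le> energy h y m n" if "m < n" "y m = u" "y n = u" for y m n
  proof -
    have "energy h (\<lambda>_. u) m n \<le> (\<Sum>i\<in>{m..<n}. h (y i) (y i))"
      unfolding energy_def by (intro sum_mono assms(2))
    also have "\<dots> \<le> energy h y m n"
      by (rule energy_loop_ge_diagonal[OF twist]) (use that in auto)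
    finally show ?thesis .
  qed
  then show ?thesis unfolding minimal_def minimal_between_def by simp
qed

lemma minimal_between_triple:
  assumes "\<And>t. h p q + h q r \<le> h p t + h t r"
  shows "minimal_between h (-1) 1 (\<lambda>i. if i < 0 then p else if i = 0 then q else r)"
    (is "minimal_between h _ _ ?x")
  unfolding minimal_between_def
proof (intro allI impI)
  fix n0 n1 :: int and y
  assume n: "-1 \<le> n0" "n0 < n1" "n1 \<le> 1" and y: "y n0 = ?x n0" "y n1 = ?x n1"
  have 1: "{n0..<n0 + 1} = {n0}" by auto
  have 2: "{-1..<1::int} = {-1, 0}" by auto
  consider "n1 = n0 + 1" | "n0 = -1" "n1 = 1" using n by linarith
  then show "energy h ?x n0 n1 \<le> energy h y n0 n1"
  proof cases
    case 1
    then show ?thesis using y unfolding energy_def \<open>n1 = n0 + 1\<close> \<open>{n0..<n0 + 1} = {n0}\<close> by simp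
  next
    case 2
    then show ?thesis using y assms[of "y 0"] unfolding energy_def by (simp add: \<open>{-1..<1::int} = {-1, 0}\<close>)
  qed
qed

lemma sum_geometric_symmetric:
  "(\<Sum>i\<in>{- int n..int n}. (1/2::real) ^ nat \<bar>i\<bar>) = 3 - 2 * (1/2) ^ n"
proof (induction n)
  case (Suc n)
  have "nat \<bar>int (Suc n)\<bar> = Suc n" "nat \<bar>- int (Suc n)\<bar> = Suc n" by auto
  then show ?case unfolding sum_symmetric_Suc Suc by simp
qed simp

lemma summable_geometric_symmetric: "(\<lambda>i::int. (1/2::real) ^ nat \<bar>i\<bar>) summable_on UNIV"
proof (rule nonneg_bdd_above_summable_on)
  show "bdd_above (sum (\<lambda>i::int. (1/2::real) ^ nat \<bar>i\<bar>) ` {F. F \<subseteq> UNIV \<and> finite F})"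
  proof (rule bdd_aboveI2)
    fix F :: "int set" assume "F \<in> {F. F \<subseteq> UNIV \<and> finite F}"
    then have F: "finite F" by simp
    define M where "M = Max (insert 0 (abs ` F))"
    have M: "\<bar>j\<bar> \<le> M" if "j \<in> F" for j
      unfolding M_def using F that by (intro Max_ge) auto
    have "0 \<le> M" unfolding M_def using F by (intro Max_ge) auto
    then have "F \<subseteq> {- int (nat M)..int (nat M)}" using M by force
    then have "(\<Sum>i\<in>F. (1/2::real) ^ nat \<bar>i\<bar>) \<le> (\<Sum>i\<in>{- int (nat M)..int (nat M)}. (1/2) ^ nat \<bar>i\<bar>)"
      by (intro sum_mono2) auto
    also have "\<dots> \<le> 3" unfolding sum_geometric_symmetric by simp
    finally show "(\<Sum>i\<in>F. (1/2::real) ^ nat \<bar>i\<bar>) \<le> 3" .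
  qed
qed simp

context twist_strip
begin

text \<open>Strictness leaves room for a small change of the single coordinate \<open>x i\<close>. Changes that leave the strip
  need no separate treatment, since clipping does not raise the energy; so the minimum is two-sided even
  where \<open>x\<close> touches a ground state.\<close>

lemma interior_local_minimum:
  assumes k: "k \<in> index_seqs" and x: "locally_minimal k \<rho> x"
    and strict: "\<And>i. \<bar>x (k i) - base i\<bar> < \<rho> i"
  obtains r where "0 < r" "\<And>t. \<bar>t - x i\<bar> < r \<Longrightarrow>
    h (x (i - 1)) (x i) + h (x i) (x (i + 1)) \<le> h (x (i - 1)) t + h t (x (i + 1))"
proof -
  have xc: "x \<in> constrained u0 u1 k \<rho>" using x by (simp add: locally_minimal_def)
  then have xs: "x \<in> strip u0 u1" by (simp add: constrained_iff)
  have "\<exists>r>0. \<forall>j. k j = i \<longrightarrow> r \<le> \<rho> j - \<bar>x i - base j\<bar>"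
  proof (cases "\<exists>j. k j = i")
    case True
    then obtain j where j: "k j = i" by blast
    have uniq: "j' = j" if "k j' = i" for j'
      using index_seqs_less_iff[OF k, of j j'] index_seqs_less_iff[OF k, of j' j] j that by linarith
    show ?thesis
    proof (intro exI conjI allI impI)
      show "0 < \<rho> j - \<bar>x i - base j\<bar>" using strict[of j] j by simp
      fix j' assume "k j' = i"
      then have "j' = j" by (rule uniq)
      then show "\<rho> j - \<bar>x i - base j\<bar> \<le> \<rho> j' - \<bar>x i - base j'\<bar>" by simp
    qed
  next
    case False
    then show ?thesis by (intro exI[of _ 1]) simp
  qed
  then obtain r where r: "0 < r" "\<And>j. k j = i \<Longrightarrow> r \<le> \<rho> j - \<bar>x i - base j\<bar>" by blast
  have "h (x (i - 1)) (x i) + h (x i) (x (i + 1)) \<le> h (x (i - 1)) t + h t (x (i + 1))"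
    if t: "\<bar>t - x i\<bar> < r" for t
  proof -
    define y where "y = x(i := t)"
    have e: "exc z (i - 1) (i + 1) = h (z (i - 1)) (z i) + h (z i) (z (i + 1)) - 2 * c" for z
      using exc_first[of "i - 1" "i + 1" z] exc_step[of z i] by simp
    have wx: "clip y j = x j" if "j \<noteq> i" for j
      using that strip_in[OF xs, of j] by (simp add: clip_def y_def)
    have wi: "\<bar>clip y i - x i\<bar> \<le> \<bar>t - x i\<bar>"
      using strip_in[OF xs, of i] by (auto simp: clip_def y_def)
    have "\<bar>clip y (k j) - base j\<bar> \<le> \<rho> j" for j
    proof (cases "k j = i")
      case True
      show ?thesis unfolding True using wi t r(2)[OF True] by linarith
    next
      case False
      then show ?thesis using wx[OF False] constrainedD[OF xc, of j] by simp
    qed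
    then have "clip y \<in> constrained u0 u1 k \<rho>" using clip_strip by (simp add: constrained_iff)
    then have "exc x (i - 1) (i + 1) \<le> exc (clip y) (i - 1) (i + 1)"
      by (rule locally_minimalD[OF x]) (use wx in auto)
    also have "\<dots> \<le> exc y (i - 1) (i + 1)"
      by (rule exc_clip_le) (use strip_in[OF xs] in \<open>auto simp: y_def\<close>)
    finally show ?thesis unfolding e by (simp add: y_def)
  qed
  then show thesis using that r(1) by blast
qed

text \<open>By semiconcavity both terms lie below parabolas with the left derivatives as slopes at \<open>x i\<close>. Their sum
  has a minimum there, so these slopes cancel.\<close>

lemma strict_imp_stationary:
  assumes \<theta>: "0 < \<theta>" "\<And>y. convex_on UNIV (\<lambda>x. \<theta> * x\<^sup>2 / 2 - h x y)"
      "\<And>x. convex_on UNIV (\<lambda>y. \<theta> * y\<^sup>2 / 2 - h x y)"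
    and k: "k \<in> index_seqs" and x: "locally_minimal k \<rho> x"
    and strict: "\<And>i. \<bar>x (k i) - base i\<bar> < \<rho> i"
  shows "stationary h x"
  unfolding stationary_def
proof
  fix i
  obtain a where a: "((\<lambda>t. h (x (i - 1)) t) has_real_derivative a) (at_left (x i))"
    "\<And>t. h (x (i - 1)) t \<le> h (x (i - 1)) (x i) + a * (t - x i) + \<theta> * (t - x i)\<^sup>2 / 2"
    using semiconcave_left_derivative[OF \<theta>(3)[of "x (i - 1)"], of "x i"] by blast
  obtain b where b: "((\<lambda>t. h t (x (i + 1))) has_real_derivative b) (at_left (x i))"
    "\<And>t. h t (x (i + 1)) \<le> h (x i) (x (i + 1)) + b * (t - x i) + \<theta> * (t - x i)\<^sup>2 / 2"
    using semiconcave_left_derivative[OF \<theta>(2)[of "x (i + 1)"], of "x i"] by blast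
  obtain r where r: "0 < r" "\<And>t. \<bar>t - x i\<bar> < r \<Longrightarrow>
    h (x (i - 1)) (x i) + h (x i) (x (i + 1)) \<le> h (x (i - 1)) t + h t (x (i + 1))"
    using interior_local_minimum[OF k x strict] by blast
  have "a + b = 0"
  proof (rule critical_slope_zero[OF \<theta>(1) r(1)])
    fix u :: real assume "\<bar>u\<bar> < r"
    then show "0 \<le> (a + b) * u + \<theta> * u\<^sup>2"
      using r(2)[of "x i + u"] a(2)[of "x i + u"] b(2)[of "x i + u"] by (simp add: algebra_simps)
  qed
  then show "\<exists>a b. ((\<lambda>t. h (x (i - 1)) t) has_real_derivative a) (at_left (x i)) \<and>
      ((\<lambda>t. h t (x (i + 1))) has_real_derivative b) (at_left (x i)) \<and> a + b = 0"
    using a(1) b(1) by blast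
qed

lemma noncritical_near_base:
  assumes v0: "u0 < v0" "v0 < u1" "v0 \<notin> crit u0 u1"
    and v1: "u0 < v1" "v1 < u1" "v1 \<notin> crit u1 u0" and d: "0 < d"
  obtains t w where "odd t" "i = t \<or> i = t + 1" "u0 < w" "w < u1" "\<bar>w - base i\<bar> < d"
    "w \<notin> crit (base t) (base (t + 1))"
proof -
  define t where "t = (if odd i then i else i - 1)"
  have t: "odd t" "i = t \<or> i = t + 1" by (auto simp: t_def)
  have ab: "{base t, base (t + 1)} = {u0, u1}" by (rule base_odd[OF t(1)])
  then have "base t = u0 \<and> base (t + 1) = u1 \<or> base t = u1 \<and> base (t + 1) = u0"
    by (auto simp: doubleton_eq_iff)
  then obtain v where v: "u0 < v" "v < u1" "v \<notin> crit (base t) (base (t + 1))"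
    using v0 v1 by metis
  have "\<exists>w. u0 < w \<and> w < u1 \<and> w \<notin> crit (base t) (base (t + 1)) \<and> \<bar>w - base i\<bar> < d"
    using t(2)
  proof
    assume "i = t"
    then show ?thesis using gap_near_source[OF ab v d] by metis
  next
    assume "i = t + 1"
    then show ?thesis using gap_near_target[OF ab v d] by metis
  qed
  then show thesis using that t by blast
qed

text \<open>The radii are chosen first, so that the boundary values of all constraints are noncritical. Each of them
  demands a certain length of the neighbouring intervals, and there are only finitely many
  demands on each interval.\<close>

lemma exists_strict_constraints:
  assumes v0: "u0 < v0" "v0 < u1" "v0 \<notin> crit u0 u1"
    and v1: "u0 < v1" "v1 < u1" "v1 \<notin> crit u1 u0" and \<epsilon>: "0 < \<epsilon>"
  obtains k \<rho> where "k \<in> index_seqs" "\<rho> \<in> radius_seqs u0 u1" "\<And>i. \<rho> i < \<epsilon>"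
    "\<And>x i. locally_minimal k \<rho> x \<Longrightarrow> \<bar>x (k i) - base i\<bar> < \<rho> i"
proof -
  define R where "R = pot u0 u1 + pot u1 u0"
  have R: "0 < R" using round_trip_pos by (simp add: R_def)
  define \<eta> where "\<eta> = R / (12 * L)"
  have \<eta>: "0 < \<eta>" "6 * L * \<eta> < pot u0 u1 + pot u1 u0"
    using R Lpos by (auto simp: \<eta>_def R_def[symmetric])
  define d where "d i = min (min \<epsilon> \<eta>) (min ((u1 - u0) / 2) ((1/2) ^ nat \<bar>i\<bar>))" for i :: int
  have d: "0 < d i" for i
    using \<epsilon> \<eta> less by (simp add: d_def)
  have d_le: "d i \<le> \<epsilon>" "d i \<le> \<eta>" "d i \<le> (u1 - u0) / 2" "d i \<le> (1/2) ^ nat \<bar>i\<bar>" for i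
    unfolding d_def by linarith+
  have "\<forall>i. \<exists>w t. odd t \<and> (i = t \<or> i = t + 1) \<and> u0 < w \<and> w < u1 \<and> \<bar>w - base i\<bar> < d i \<and>
    w \<notin> crit (base t) (base (t + 1))"
    using noncritical_near_base[OF v0 v1 d] by metis
  then obtain w T where wT: "\<forall>i. odd (T i) \<and> (i = T i \<or> i = T i + 1) \<and> u0 < w i \<and> w i < u1 \<and> \<bar>w i - base i\<bar> < d i \<and>
    w i \<notin> crit (base (T i)) (base (T i + 1))" by metis
  then have w: "odd (T i)" "i = T i \<or> i = T i + 1" "u0 < w i" "w i < u1" "\<bar>w i - base i\<bar> < d i"
    "w i \<notin> crit (base (T i)) (base (T i + 1))" for i by blast+
  define \<rho> where "\<rho> i = \<bar>w i - base i\<bar>" for i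
  have \<rho>pos: "0 < \<rho> i" for i using w(3,4)[of i] by (simp add: \<rho>_def base_def)
  have \<rho>d: "\<rho> i < d i" for i using w(5) by (simp add: \<rho>_def)
  have \<rho>_le: "\<rho> i \<le> (1/2) ^ nat \<bar>i\<bar>" for i using \<rho>d[of i] d_le(4)[of i] by linarith
  have "\<rho> summable_on UNIV"
    by (rule summable_on_comparison_test[OF summable_geometric_symmetric])
      (use \<rho>pos \<rho>_le in \<open>auto intro: less_imp_le\<close>)
  then have \<rho>: "\<rho> \<in> radius_seqs u0 u1"
    using \<rho>pos less_le_trans[OF \<rho>d d_le(3)] by (simp add: radius_seqs_def)
  have \<rho>\<eta>: "0 \<le> \<rho> i \<and> \<rho> i \<le> \<eta>" for i using \<rho>pos[of i] \<rho>d[of i] d_le(2)[of i] by linarith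
  have "\<exists>N::nat. \<forall>k x. k \<in> index_seqs \<longrightarrow> locally_minimal k \<rho> x \<longrightarrow>
      (\<forall>j\<in>{i - 2..i + 1}. int N \<le> k (j + 1) - k j) \<longrightarrow> x (k i) \<noteq> w i" for i
  proof -
    have wi: "w i \<in> {u0..u1}" using w(3,4)[of i] by simp
    obtain N :: nat where N: "\<And>k \<rho> x t i'. k \<in> index_seqs \<Longrightarrow> locally_minimal k \<rho> x \<Longrightarrow> (\<And>j. 0 \<le> \<rho> j \<and> \<rho> j \<le> \<eta>) \<Longrightarrow> odd t \<Longrightarrow>
       base t = base (T i) \<Longrightarrow> base (t + 1) = base (T i + 1) \<Longrightarrow> i' = t \<or> i' = t + 1 \<Longrightarrow>
       (\<And>j. t - 1 \<le> j \<Longrightarrow> j \<le> t + 1 \<Longrightarrow> int N \<le> k (j + 1) - k j) \<Longrightarrow> x (k i') \<noteq> w i"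
      using avoids_noncritical_value[OF base_odd[OF w(1)[of i]] wi w(6)[of i] \<eta>] by blast
    have "x (k i) \<noteq> w i" if k: "k \<in> index_seqs" "locally_minimal k \<rho> x"
      and long: "\<forall>j\<in>{i - 2..i + 1}. int N \<le> k (j + 1) - k j" for k x
    proof (rule N[OF k \<rho>\<eta> w(1)[of i] refl refl w(2)[of i]])
      fix j assume "T i - 1 \<le> j" "j \<le> T i + 1"
      then have "j \<in> {i - 2..i + 1}" using w(2)[of i] by auto
      then show "int N \<le> k (j + 1) - k j" using long by blast
    qed
    then show ?thesis by blast
  qed
  then obtain N :: "int \<Rightarrow> nat" where N: "\<And>i k x. k \<in> index_seqs \<Longrightarrow> locally_minimal k \<rho> x \<Longrightarrow>
      (\<forall>j\<in>{i - 2..i + 1}. int (N i) \<le> k (j + 1) - k j) \<Longrightarrow> x (k i) \<noteq> w i"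
    by metis
  define len where "len j = (\<Sum>i\<in>{j - 1..j + 2}. int (N i)) + 1" for j :: int
  have "0 < len j" for j
    using sum_nonneg[of "{j - 1..j + 2}" "\<lambda>i. int (N i)"] by (simp add: len_def)
  then obtain k where k: "k \<in> index_seqs" "\<And>i. k (i + 1) - k i = len i"
    using index_seqs_exists by blast
  have strict: "\<bar>x (k i) - base i\<bar> < \<rho> i" if x: "locally_minimal k \<rho> x" for x i
  proof -
    have xc: "x \<in> constrained u0 u1 k \<rho>" using x by (simp add: locally_minimal_def)
    have "x (k i) \<noteq> w i"
    proof (rule N[OF k(1) x], rule ballI)
      fix j assume "j \<in> {i - 2..i + 1}"
      then have "int (N i) \<le> (\<Sum>i\<in>{j - 1..j + 2}. int (N i))"
        by (intro member_le_sum) auto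
      then show "int (N i) \<le> k (j + 1) - k j" by (simp add: k(2) len_def)
    qed
    moreover have "x (k i) \<in> {u0..u1}" using xc strip_in by (simp add: constrained_iff)
    ultimately have "\<bar>x (k i) - base i\<bar> \<noteq> \<rho> i"
      using w(3,4)[of i] by (auto simp: \<rho>_def base_def split: if_splits)
    then show ?thesis using constrainedD[OF xc, of i] by simp
  qed
  have small: "\<rho> i < \<epsilon>" for i using \<rho>d[of i] d_le(1)[of i] by linarith
  show thesis by (rule that[of k \<rho>], rule k(1), rule \<rho>, rule small, rule strict)
qed

end

section \<open>Infinite transition configurations\<close>

theorem theorem3p9:
  fixes h :: "real \<Rightarrow> real \<Rightarrow> real" and u0 u1 :: real
  assumes lip: "\<exists>L. L-lipschitz_on UNIV (\<lambda>(\<xi>, \<eta>). h \<xi> \<eta>)"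
    and h1: "\<And>\<xi> \<eta>. h \<xi> \<eta> = h (\<xi> + 1) (\<eta> + 1)"
    and h2: "\<And>M. \<forall>\<^sub>F \<eta> in at_infinity. \<forall>\<xi>. h \<xi> (\<xi> + \<eta>) > M"
    and h3: "\<And>\<xi> \<xi>' \<eta> \<eta>'. \<xi> < \<xi>' \<Longrightarrow> \<eta> < \<eta>' \<Longrightarrow> h \<xi> \<eta> + h \<xi>' \<eta>' < h \<xi> \<eta>' + h \<xi>' \<eta>"
    and h4: "\<And>x \<xi> :: config. minimal_between h (-1) 1 x \<Longrightarrow> minimal_between h (-1) 1 \<xi> \<Longrightarrow>
               x 0 = \<xi> 0 \<Longrightarrow> (x (-1), x 0, x 1) \<noteq> (\<xi> (-1), \<xi> 0, \<xi> 1) \<Longrightarrow>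
               (x (-1) - \<xi> (-1)) * (x 1 - \<xi> 1) < 0"
    and h5: "\<exists>p :: real \<times> real \<Rightarrow> real. continuous_on UNIV p \<and> (\<forall>z. p z > 0) \<and>
               (\<forall>\<xi> \<eta> \<xi>' \<eta>'. \<xi> < \<eta> \<longrightarrow> \<xi>' < \<eta>' \<longrightarrow>
                  h \<xi> \<eta>' + h \<eta> \<xi>' - h \<xi> \<xi>' - h \<eta> \<eta>'
                    > integral {\<xi>..\<eta>} (\<lambda>s. integral {\<xi>'..\<eta>'} (\<lambda>t. p (s, t))))"
    and h6: "\<exists>\<theta>>0. (\<forall>\<xi>'. convex_on UNIV (\<lambda>\<xi>. \<theta> * \<xi>\<^sup>2 / 2 - h \<xi> \<xi>')) \<and>
                    (\<forall>\<xi>. convex_on UNIV (\<lambda>\<xi>'. \<theta> * \<xi>'\<^sup>2 / 2 - h \<xi> \<xi>'))"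
    and pair: "neighboring_pair h u0 u1"
    and gap0: "{u0<..<u1} - connecting h u0 u1 \<noteq> {}"
    and gap1: "{u0<..<u1} - connecting h u1 u0 \<noteq> {}"
  shows "\<forall>\<epsilon>>0. \<exists>k\<in>index_seqs. \<exists>\<rho>\<in>radius_seqs u0 u1. (\<forall>i. \<rho> i < \<epsilon>) \<and>
           (\<exists>x. is_arg_min (action h u0 u1 k \<rho>) (\<lambda>y. y \<in> constrained u0 u1 k \<rho>) x \<and>
                stationary h x \<and> has_rotation_number x 0)"
proof (intro allI impI)
  fix \<epsilon> :: real assume \<epsilon>: "0 < \<epsilon>"
  obtain L where L: "L-lipschitz_on UNIV (\<lambda>(\<xi>, \<eta>). h \<xi> \<eta>)" using lip by blast
  then have L0: "0 \<le> L" by (rule lipschitz_on_nonneg)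
  have lip2: "\<bar>h x y - h x' y'\<bar> \<le> L * dist (x, y) (x', y')" for x y x' y'
    using lipschitz_onD[OF L, of "(x, y)" "(x', y')"] by (simp add: dist_real_def)
  have minc: "minimal h (\<lambda>_. u0)" "minimal h (\<lambda>_. u1)" and less: "u0 < u1"
    and nomin: "\<And>u. u0 < u \<Longrightarrow> u < u1 \<Longrightarrow> \<not> minimal h (\<lambda>_. u)"
    using pair by (auto simp: neighboring_pair_def)
  interpret twist_strip h u0 u1 "L + 1" "h u0 u0"
  proof
    show "\<bar>h x y - h x' y\<bar> \<le> (L + 1) * \<bar>x - x'\<bar>" for x x' y
      using lip2[of x y x' y] by (simp add: dist_Pair_Pair dist_real_def distrib_right)
    show "\<bar>h x y - h x y'\<bar> \<le> (L + 1) * \<bar>y - y'\<bar>" for x y y'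
      using lip2[of x y x y'] by (simp add: dist_Pair_Pair dist_real_def distrib_right)
    show "(p - p') * (r - r') < 0"
      if "\<And>t. h p q + h q r \<le> h p t + h t r" "\<And>t. h p' q + h q r' \<le> h p' t + h t r'" "(p, r) \<noteq> (p', r')"
      for p p' q r r'
      using h4[OF minimal_between_triple[OF that(1)] minimal_between_triple[OF that(2)]] that(3) by simp
    show "h u0 u0 < h v v" if v: "u0 < v" "v < u1" for v
    proof (rule ccontr)
      assume "\<not> ?thesis"
      then have "h v v \<le> h w w" for w
        using minimal_constant_diagonal[OF minc(1), of w] by simp
      then show False using nomin[OF v] minimal_constantI[of h v, OF h3] by blast
    qed
    show "h u1 u1 = h u0 u0"
      using minimal_constant_diagonal[OF minc(1), of u1] minimal_constant_diagonal[OF minc(2), of u0] by simp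
  qed (use less L0 h3 minimal_constant_diagonal[OF minc(1)] in auto)
  obtain v0 where v0: "u0 < v0" "v0 < u1" "v0 \<notin> crit u0 u1"
    using gap0 crit_connecting[of u0 u1] by fastforce
  obtain v1 where v1: "u0 < v1" "v1 < u1" "v1 \<notin> crit u1 u0"
    using gap1 crit_connecting[of u1 u0, OF insert_commute] by fastforce
  obtain k \<rho> where k\<rho>: "k \<in> index_seqs" "\<rho> \<in> radius_seqs u0 u1" "\<And>i. \<rho> i < \<epsilon>"
    "\<And>x i. locally_minimal k \<rho> x \<Longrightarrow> \<bar>x (k i) - base i\<bar> < \<rho> i"
    using exists_strict_constraints[OF v0 v1 \<epsilon>] by blast
  obtain x where x: "is_arg_min (action h u0 u1 k \<rho>) (\<lambda>y. y \<in> constrained u0 u1 k \<rho>) x"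
    "locally_minimal k \<rho> x"
    using exists_action_minimizer[OF k\<rho>(1,2)] by blast
  obtain \<theta> where \<theta>: "0 < \<theta>" "\<And>y. convex_on UNIV (\<lambda>x. \<theta> * x\<^sup>2 / 2 - h x y)"
      "\<And>x. convex_on UNIV (\<lambda>y. \<theta> * y\<^sup>2 / 2 - h x y)"
    using h6 by blast
  have "stationary h x"
    by (rule strict_imp_stationary[OF \<theta> k\<rho>(1) x(2) k\<rho>(4)[OF x(2)]])
  moreover have "x \<in> strip u0 u1"
    using x(2) by (simp add: locally_minimal_def constrained_iff)
  then have "has_rotation_number x 0" by (rule strip_rotation_number)
  ultimately show "\<exists>k\<in>index_seqs. \<exists>\<rho>\<in>radius_seqs u0 u1. (\<forall>i. \<rho> i < \<epsilon>) \<and>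
           (\<exists>x. is_arg_min (action h u0 u1 k \<rho>) (\<lambda>y. y \<in> constrained u0 u1 k \<rho>) x \<and>
                stationary h x \<and> has_rotation_number x 0)"
    using k\<rho>(1-3) x(1) by blast
qed

end
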